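(* Fix $r\ge 2$ and $M>0$. Suppose $H_n\sim\mathsf{H}_{[r]}(n,\boldsymbol B)$ is a sample from the $r$-layered hypergraph $\boldsymbol\beta$-model with $\boldsymbol B=(\boldsymbol\beta_2,\ldots,\boldsymbol\beta_r)$ and $\|\boldsymbol\beta_s\|_\infty\le M$ for all $2\le s\le r$. Fix any integers $a_2,\ldots,a_r\ge 1$ and any subsets of nodes $J_2,\ldots,J_r\subseteq[n]$ with cardinalities $a_2,\ldots,a_r$, respectively. Then, for all $\alpha\in(0,1)$, $$\lim_{n\to\infty}\mathbb P\left(\sum_{s=2}^r([\hat{\boldsymbol\beta}_s-\boldsymbol\beta_s]_{J_s})^\top[\hat{\boldsymbol D}_s^2]_{J_s}([\hat{\boldsymbol\beta}_s-\boldsymbol\beta_s]_{J_s})\le\chi^2_{\sum_{s=2}^r a_s,\,1-\alpha}\right)=1-\alpha,$$ where $[\hat{\boldsymbol D}_s^2]_{J_s}=\mathrm{diag}(\hat\sigma_s(v)^2)_{v\in J_s}$ for $2\le s\le r$, and for $a\ge 1$, $\chi^2_{a,1-\alpha}$ is the $(1-\alpha)$-th quantile of the chi-squared distribution with $a$ degrees of freedom.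
   Context: $[n]=\{1,\ldots,n\}$ and $\binom{A}{k}$ is the collection of $k$-element subsets of $A$. For $\boldsymbol x\in\mathbb R^n$, $[\boldsymbol x]_{J}=(x_v)_{v\in J}^\top$. The $r$-layered hypergraph $\boldsymbol\beta$-model $\mathsf{H}_{[r]}(n,\boldsymbol B)$, with $\boldsymbol\beta_s=(\beta_{s,v})_{v\in[n]}\in\mathbb R^n$, is the random hypergraph on $[n]$ in which, for every $2\le s\le r$, each hyperedge $\{v_1,\ldots,v_s\}\in\binom{[n]}{s}$ is present independently with probability $\frac{e^{\beta_{s,v_1}+\cdots+\beta_{s,v_s}}}{1+e^{\beta_{s,v_1}+\cdots+\beta_{s,v_s}}}$. The $s$-degree $d_s(v)$ is the number of hyperedges of size $s$ in $H_n$ containing $v$. The maximum likelihood (ML) estimate $\hat{\boldsymbol\beta}_s=(\hat\beta_{s,v})_{v\in[n]}$ is the minimizer over $\boldsymbol\beta\in\mathbb R^n$ of $\ell_{n,s}(\boldsymbol\beta)=\sum_{\{v_1,\ldots,v_s\}\in\binom{[n]}{s}}\log(1+e^{\beta_{v_1}+\cdots+\beta_{v_s}})-\sum_{v=1}^n\beta_v d_s(v)$; it exists and is unique with probability $1-o(1)$ (define it arbitrarily otherwise). The plug-in variance estimate is $$\hat\sigma_s(v)^2=\sum_{\{v_2,\ldots,v_s\}\in\binom{[n]\setminus\{v\}}{s-1}}\frac{e^{\hat\beta_{s,v}+\hat\beta_{s,v_2}+\cdots+\hat\beta_{s,v_s}}}{(1+e^{\hat\beta_{s,v}+\hat\beta_{s,v_2}+\cdots+\hat\beta_{s,v_s}})^2}.$$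 The parameters may depend on $n$; $r$, $M$ and the $a_s$ are fixed. *)

theory Defs
  imports "HOL-Probability.Probability" "HOL-Library.Ramsey"
begin

text \<open>
  Nodes are the natural numbers in \<open>{1..n}\<close>, a hyperedge is a finite set of nodes, and a
  hypergraph is its set of hyperedges. The \<open>k\<close>-element subsets of \<open>A\<close> are \<open>nsets A k\<close>.
  A vector in \<open>\<real>\<^sup>n\<close> is a function \<open>nat \<Rightarrow> real\<close> of which only the values on \<open>{1..n}\<close> matter; where
  uniqueness is at stake it is taken in \<open>extensional {1..n}\<close>. A layered parameter
  \<open>B = (\<beta>\<^sub>2, \<dots>, \<beta>\<^sub>r)\<close> is a function with \<open>B s v = \<beta>\<^sub>s\<^sub>,\<^sub>v\<close>.
\<close>

definition hyperedges :: "nat \<Rightarrow> nat \<Rightarrow> nat set set" where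
  "hyperedges r n = (\<Union>s\<in>{2..r}. nsets {1..n} s)"

definition edge_prob :: "(nat \<Rightarrow> real) \<Rightarrow> nat set \<Rightarrow> real" where
  "edge_prob \<beta> e = exp (\<Sum>v\<in>e. \<beta> v) / (1 + exp (\<Sum>v\<in>e. \<beta> v))"

definition layered_beta_model :: "nat \<Rightarrow> nat \<Rightarrow> (nat \<Rightarrow> nat \<Rightarrow> real) \<Rightarrow> nat set set pmf" where
  "layered_beta_model r n B =
     map_pmf (\<lambda>X. {e \<in> hyperedges r n. X e})
       (Pi_pmf (hyperedges r n) False (\<lambda>e. bernoulli_pmf (edge_prob (B (card e)) e)))"

definition sdegree :: "nat \<Rightarrow> nat set set \<Rightarrow> nat \<Rightarrow> nat" where
  "sdegree s H v = card {e \<in> H. card e = s \<and> v \<in> e}"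

definition neg_log_lik :: "nat \<Rightarrow> nat \<Rightarrow> nat set set \<Rightarrow> (nat \<Rightarrow> real) \<Rightarrow> real" where
  "neg_log_lik n s H \<beta> =
     (\<Sum>e\<in>nsets {1..n} s. ln (1 + exp (\<Sum>v\<in>e. \<beta> v)))
     - (\<Sum>v=1..n. \<beta> v * real (sdegree s H v))"

definition is_ml_estimate :: "nat \<Rightarrow> nat \<Rightarrow> nat set set \<Rightarrow> (nat \<Rightarrow> real) \<Rightarrow> bool" where
  "is_ml_estimate n s H \<beta> \<longleftrightarrow>
     is_arg_min (neg_log_lik n s H) (\<lambda>b. b \<in> extensional {1..n}) \<beta>"

text \<open>
  An ML estimator returns the minimizer whenever it exists and is unique; its values on all
  other hypergraphs are arbitrary.
\<close>

definition ml_estimator ::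
    "nat \<Rightarrow> nat \<Rightarrow> nat \<Rightarrow> (nat set set \<Rightarrow> nat \<Rightarrow> real) \<Rightarrow> bool" where
  "ml_estimator r n s est \<longleftrightarrow>
     (\<forall>H \<subseteq> hyperedges r n.
        (\<exists>!\<beta>. is_ml_estimate n s H \<beta>) \<longrightarrow> is_ml_estimate n s H (est H))"

text \<open>\<open>plugin_var n s \<beta> v\<close> is \<open>\<sigma>\<^sub>s(v)\<^sup>2\<close> (the square included) at the parameter \<open>\<beta>\<close>.\<close>

definition plugin_var :: "nat \<Rightarrow> nat \<Rightarrow> (nat \<Rightarrow> real) \<Rightarrow> nat \<Rightarrow> real" where
  "plugin_var n s \<beta> v =
     (\<Sum>e\<in>nsets ({1..n} - {v}) (s - 1).
        exp (\<beta> v + (\<Sum>u\<in>e. \<beta> u)) / (1 + exp (\<beta> v + (\<Sum>u\<in>e. \<beta> u)))\<^sup>2)"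

definition diag :: "('a \<Rightarrow> real) \<Rightarrow> 'a \<Rightarrow> 'a \<Rightarrow> real" where
  "diag d u v = (if u = v then d u else 0)"

text \<open>\<open>x\<^sup>T A x\<close> for the subvector and the submatrix indexed by \<open>J\<close>.\<close>

definition quad_form :: "'a set \<Rightarrow> ('a \<Rightarrow> 'a \<Rightarrow> real) \<Rightarrow> ('a \<Rightarrow> real) \<Rightarrow> real" where
  "quad_form J A x = (\<Sum>u\<in>J. \<Sum>v\<in>J. x u * A u v * x v)"

text \<open>The law of the sum of squares of \<open>k\<close> independent standard normal variables.\<close>

definition chi_squared :: "nat \<Rightarrow> real measure" where
  "chi_squared k =
     distr (\<Pi>\<^sub>M i\<in>{..<k}. density lborel std_normal_density) borel (\<lambda>x. \<Sum>i<k. (x i)\<^sup>2)"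

definition quantile :: "real measure \<Rightarrow> real \<Rightarrow> real" where
  "quantile \<mu> p = Inf {x. p \<le> cdf \<mu> x}"

end

theory Submission
  imports Defs "HOL-Real_Asymp.Real_Asymp"
begin

text \<open>
  Fix a layer \<open>s\<close>, let \<open>m\<close> and \<open>m\<^sub>2\<close> be the numbers of \<open>s\<close>-subsets of \<open>{1..n}\<close> containing one and
  two given nodes, and let \<open>\<xi>\<^sub>v\<close> be the centred degree of \<open>v\<close>, whose covariance matrix is the Hessian
  of the negative log-likelihood at the true parameter. By Hoeffding's inequality all \<open>\<xi>\<^sub>v\<close> are
  small compared with \<open>m\<close>, and then strong convexity bounds the \<open>\<ell>\<^sub>1\<close>-error of the minimizer over a
  unit box around the true parameter; the likelihood equation of each coordinate upgrades this to
  a bound in the supremum norm, so that the minimizer is interior and is the ML estimate.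

  Expanding the likelihood equation at \<open>v\<close> to first order gives
  \<open>\<sigma>(v)\<^sup>2 (\<beta>'\<^sub>v - \<beta>\<^sub>v) = \<xi>\<^sub>v - \<Sum>\<^sub>u b\<^sub>u \<xi>\<^sub>u + error\<close>, where \<open>b\<close> solves \<open>H b = a\<close> for the Hessian \<open>H\<close> and
  the off-diagonal part \<open>a\<close> of its row \<open>v\<close>. The variance of the sum is \<open>b\<^sup>T H b = a\<^sup>T b = O(m\<^sub>2)\<close>,
  which is negligible compared with \<open>\<sigma>(v)\<^sup>2\<close>, of order \<open>m\<close>. Dropping from \<open>\<xi>\<^sub>v\<close> the hyperedges
  that meet \<open>J\<^sub>s\<close> in another node is equally harmless and makes the variables for the different
  \<open>v \<in> J\<^sub>s\<close> and \<open>s\<close> independent. Hence the statistic is asymptotically a sum of squares of independent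
  asymptotically normal variables, and characteristic functions give the chi-squared limit.
\<close>

section \<open>The logistic function and subset counts\<close>

definition logistic :: "real \<Rightarrow> real" where
  "logistic x = exp x / (1 + exp x)"

text \<open>The derivative of \<open>logistic\<close>. At an edge sum it is both the second
  derivative of \<open>ln (1 + exp x)\<close> and the variance p (1 - p) of the edge indicator, so
  Hessian and covariance matrix coincide at the true parameter.\<close>

definition logistic_density :: "real \<Rightarrow> real" where
  "logistic_density x = exp x / (1 + exp x)\<^sup>2"

lemma one_plus_exp_pos: "1 + exp x > (0::real)"
  by (simp add: add_pos_pos)

lemma one_plus_exp_neq_0 [simp]: "1 + exp x \<noteq> (0::real)"
  using one_plus_exp_pos[of x] by linarith

lemma logistic_bounds: "0 < logistic x" "logistic x < 1"
  using one_plus_exp_pos[of x] by (simp_all add: logistic_def)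

lemma logistic_density_eq: "logistic_density x = logistic x * (1 - logistic x)"
  by (simp add: logistic_density_def logistic_def field_simps power2_eq_square)

lemma logistic_density_pos: "logistic_density x > 0"
  using logistic_bounds[of x] by (simp add: logistic_density_eq)

lemma logistic_density_le: "logistic_density x \<le> 1/4"
proof -
  have "1/4 - logistic_density x = (logistic x - 1/2)\<^sup>2"
    by (simp add: logistic_density_eq power2_eq_square algebra_simps)
  thus ?thesis using zero_le_power2[of "logistic x - 1/2"] by linarith
qed

text \<open>The denominator \<open>(1 + exp x)\<^sup>2\<close> is at most
  \<open>(2 * exp x)\<^sup>2\<close> for nonnegative x and at most 4 for negative x; either way it
  is at most \<open>4 * exp R\<close> times the numerator.\<close>

lemma logistic_density_ge:
  assumes "\<bar>x\<bar> \<le> R"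
  shows "exp (-R) / 4 \<le> logistic_density x"
proof -
  have *: "(1 + exp x)\<^sup>2 \<le> 4 * exp R * exp x"
  proof (cases "x \<ge> 0")
    case True
    have "(1 + exp x)\<^sup>2 \<le> (2 * exp x)\<^sup>2"
      using True by (intro power_mono) auto
    also have "\<dots> = 4 * exp x * exp x" by (simp add: power2_eq_square)
    also have "\<dots> \<le> 4 * exp R * exp x"
      using assms by (intro mult_right_mono mult_left_mono) auto
    finally show ?thesis .
  next
    case False
    have "(1 + exp x)\<^sup>2 \<le> 2\<^sup>2"
      using False by (intro power_mono) auto
    also have "\<dots> = 4 * 1" by simp
    also have "1 \<le> exp (R + x)" using assms by simp
    finally show ?thesis by (simp add: exp_add)
  qed
  show ?thesis
    unfolding logistic_density_def using * one_plus_exp_pos[of x]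
    by (simp add: divide_simps exp_minus mult_ac)
qed

lemma DERIV_softplus: "((\<lambda>x. ln (1 + exp x)) has_real_derivative logistic x) (at x)"
  unfolding logistic_def using one_plus_exp_pos[of x]
  by (auto intro!: derivative_eq_intros)

lemma DERIV_logistic: "(logistic has_real_derivative logistic_density x) (at x)"
  unfolding logistic_def[abs_def] logistic_density_def
  by (auto intro!: derivative_eq_intros simp: field_simps power2_eq_square)

lemma DERIV_logistic_density:
  "(logistic_density has_real_derivative logistic_density x * (1 - 2 * logistic x)) (at x)"
proof -
  have "((\<lambda>x. logistic x * (1 - logistic x)) has_real_derivative
      logistic_density x * (1 - 2 * logistic x)) (at x)"
    by (auto intro!: derivative_eq_intros DERIV_logistic simp: algebra_simps)
  thus ?thesis by (simp add: logistic_density_eq[abs_def])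
qed

lemma logistic_density_deriv_le: "\<bar>logistic_density x * (1 - 2 * logistic x)\<bar> \<le> 1"
proof -
  have "\<bar>logistic_density x\<bar> * \<bar>1 - 2 * logistic x\<bar> \<le> 1 * 1"
    using logistic_bounds[of x] logistic_density_pos[of x] logistic_density_le[of x]
    by (intro mult_mono) auto
  thus ?thesis by (simp add: abs_mult)
qed

lemma taylor_two_real:
  fixes f f' f'' :: "real \<Rightarrow> real"
  assumes "\<And>x. (f has_real_derivative f' x) (at x)" "\<And>x. (f' has_real_derivative f'' x) (at x)"
  obtains t where "min x y \<le> t" "t \<le> max x y"
    "f y = f x + f' x * (y - x) + f'' t / 2 * (y - x)\<^sup>2"
proof (cases "x = y")
  case True
  thus ?thesis using that[of x] by auto
next
  case False
  \<comment> \<open>The derivatives as one sequence indexed by their order, the shape in which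
    \<open>Taylor\<close> takes them.\<close>
  define d where "d k = (if k = 0 then f else if k = 1 then f' else f'')" for k :: nat
  have "\<exists>t. (if y < x then y < t \<and> t < x else x < t \<and> t < y) \<and>
     f y = (\<Sum>k<2. (d k x / fact k) * (y - x) ^ k) + (d 2 t / fact 2) * (y - x) ^ 2"
    using False assms
    by (intro Taylor[where a = "min x y" and b = "max x y"])
       (auto simp: d_def less_Suc_eq numeral_2_eq_2)
  then obtain t where "if y < x then y < t \<and> t < x else x < t \<and> t < y"
     "f y = (\<Sum>k<2. (d k x / fact k) * (y - x) ^ k) + (d 2 t / fact 2) * (y - x) ^ 2" by blast
  thus ?thesis
    by (intro that[of t]) (auto simp: d_def numeral_2_eq_2 split: if_splits)
qed

lemma mvt_real:
  fixes f f' :: "real \<Rightarrow> real"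
  assumes "\<And>x. (f has_real_derivative f' x) (at x)"
  obtains t where "min x y \<le> t" "t \<le> max x y" "f y - f x = f' t * (y - x)"
proof -
  consider "x < y" | "x = y" | "y < x" by linarith
  thus ?thesis
  proof cases
    case 1
    from MVT2[OF 1, of f f'] assms obtain z where "z > x" "z < y" "f y - f x = (y - x) * f' z"
      by blast
    thus ?thesis using 1 by (intro that[of z]) (auto simp: mult_ac)
  next
    case 2 thus ?thesis using that[of x] by auto
  next
    case 3
    from MVT2[OF 3, of f f'] assms obtain z where "z > y" "z < x" "f x - f y = (x - y) * f' z"
      by blast
    thus ?thesis using 3 by (intro that[of z]) (auto simp: algebra_simps)
  qed
qed

text \<open>Strong convexity on an interval of radius R: the quadratic coefficient is half the lower
  bound of \<open>logistic_density\<close> there.\<close>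

lemma softplus_ge_quadratic:
  assumes "\<bar>x\<bar> \<le> R" "\<bar>y\<bar> \<le> R"
  shows "ln (1 + exp y) \<ge> ln (1 + exp x) + logistic x * (y - x) + exp (-R) / 8 * (y - x)\<^sup>2"
proof -
  obtain t where t: "min x y \<le> t" "t \<le> max x y"
    "ln (1 + exp y) = ln (1 + exp x) + logistic x * (y - x) + logistic_density t / 2 * (y - x)\<^sup>2"
    using taylor_two_real[OF DERIV_softplus DERIV_logistic] by metis
  have "exp (-R) / 8 * (y - x)\<^sup>2 \<le> logistic_density t / 2 * (y - x)\<^sup>2"
    using logistic_density_ge[of t R] t assms
    by (intro mult_right_mono) (auto simp: min_def max_def split: if_splits)
  thus ?thesis using t by linarith
qed

text \<open>Strict convexity on the whole line, because any two points lie in a bounded interval on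
  which strong convexity holds.\<close>

lemma softplus_gt_tangent:
  assumes "x \<noteq> y"
  shows "ln (1 + exp y) > ln (1 + exp x) + logistic x * (y - x)"
proof -
  have "exp (- max \<bar>x\<bar> \<bar>y\<bar>) / 8 * (y - x)\<^sup>2 > 0" using assms by simp
  with softplus_ge_quadratic[of x "max \<bar>x\<bar> \<bar>y\<bar>" y] show ?thesis by simp
qed

lemma logistic_diff_abs_le: "\<bar>logistic y - logistic x\<bar> \<le> \<bar>y - x\<bar> / 4"
proof -
  obtain t where t: "logistic y - logistic x = logistic_density t * (y - x)"
    using mvt_real[OF DERIV_logistic] by metis
  have "\<bar>logistic_density t * (y - x)\<bar> \<le> 1/4 * \<bar>y - x\<bar>"
    unfolding abs_mult using logistic_density_le[of t] logistic_density_pos[of t]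
    by (intro mult_right_mono) auto
  thus ?thesis using t by simp
qed

lemma logistic_diff_ge:
  assumes "\<bar>x\<bar> \<le> R" "\<bar>y\<bar> \<le> R" "x \<le> y"
  shows "logistic y - logistic x \<ge> exp (-R) / 4 * (y - x)"
proof -
  obtain t where t: "min x y \<le> t" "t \<le> max x y" "logistic y - logistic x = logistic_density t * (y - x)"
    using mvt_real[OF DERIV_logistic] by metis
  have "exp (-R) / 4 * (y - x) \<le> logistic_density t * (y - x)"
    using logistic_density_ge[of t R] t assms by (intro mult_right_mono) auto
  thus ?thesis using t by simp
qed

lemma logistic_taylor: "\<bar>logistic y - logistic x - logistic_density x * (y - x)\<bar> \<le> (y - x)\<^sup>2"
proof -
  obtain t where t:
    "logistic y = logistic x + logistic_density x * (y - x)
       + logistic_density t * (1 - 2 * logistic t) / 2 * (y - x)\<^sup>2"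
    using taylor_two_real[OF DERIV_logistic DERIV_logistic_density] by metis
  have "\<bar>logistic_density t * (1 - 2 * logistic t) / 2 * (y - x)\<^sup>2\<bar> \<le> 1 * (y - x)\<^sup>2"
    unfolding abs_mult using logistic_density_deriv_le[of t]
    by (intro mult_mono) (auto simp: abs_mult)
  thus ?thesis using t by simp
qed

lemma logistic_density_diff_abs_le: "\<bar>logistic_density y - logistic_density x\<bar> \<le> \<bar>y - x\<bar>"
proof -
  obtain t where t: "logistic_density y - logistic_density x
      = logistic_density t * (1 - 2 * logistic t) * (y - x)"
    using mvt_real[OF DERIV_logistic_density] by metis
  have "\<bar>logistic_density t * (1 - 2 * logistic t) * (y - x)\<bar> \<le> 1 * \<bar>y - x\<bar>"
    unfolding abs_mult[of _ "y-x"] using logistic_density_deriv_le[of t]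
    by (intro mult_right_mono) auto
  thus ?thesis using t by simp
qed

section \<open>Counting k-element subsets through one or two given points\<close>

lemma bij_betw_insert_nsets:
  assumes "v \<in> A" "k > 0"
  shows "bij_betw (insert v) (nsets (A - {v}) (k - 1)) {e \<in> nsets A k. v \<in> e}"
proof (intro bij_betw_byWitness[where f' = "\<lambda>e. e - {v}"] ballI subsetI)
  fix e assume "e \<in> nsets (A - {v}) (k - 1)"
  thus "insert v e - {v} = e" by (auto simp: nsets_def)
next
  fix e assume "e \<in> insert v ` nsets (A - {v}) (k - 1)"
  then obtain e' where "e = insert v e'" "e' \<in> nsets (A - {v}) (k - 1)" by blast
  moreover from this have "v \<notin> e'" by (auto simp: nsets_def)
  ultimately show "e \<in> {e \<in> nsets A k. v \<in> e}" using assms by (auto simp: nsets_def)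
qed (auto simp: nsets_def)

lemma card_nsets_containing:
  assumes "finite A" "v \<in> A" "k > 0"
  shows "card {e \<in> nsets A k. v \<in> e} = (card A - 1) choose (k - 1)"
  using bij_betw_same_card[OF bij_betw_insert_nsets[OF assms(2,3)]] assms
  by (simp add: card_nsets)

lemma card_nsets_containing_two:
  assumes "finite A" "u \<in> A" "v \<in> A" "u \<noteq> v" "k > 1"
  shows "card {e \<in> nsets A k. u \<in> e \<and> v \<in> e} = (card A - 2) choose (k - 2)"
proof -
  have "bij_betw (insert v) {e \<in> nsets (A - {v}) (k - 1). u \<in> e} {e \<in> nsets A k. u \<in> e \<and> v \<in> e}"
  proof (rule bij_betw_subset[OF bij_betw_insert_nsets[of v A k]])
    show "insert v ` {e \<in> nsets (A - {v}) (k - 1). u \<in> e} = {e \<in> nsets A k. u \<in> e \<and> v \<in> e}"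
    proof -
      have "insert v ` nsets (A - {v}) (k - 1) = {e \<in> nsets A k. v \<in> e}"
        using bij_betw_insert_nsets[of v A k] assms by (auto simp: bij_betw_def)
      thus ?thesis using assms(4) by blast
    qed
  qed (use assms in auto)
  from bij_betw_same_card[OF this] show ?thesis
    using card_nsets_containing[of "A - {v}" u "k - 1"] assms by (simp add: numeral_2_eq_2)
qed

lemma sum_incidence_swap:
  assumes "finite A"
  shows "(\<Sum>e\<in>nsets A k. \<Sum>v\<in>e. g v e) = (\<Sum>v\<in>A. \<Sum>e\<in>{e \<in> nsets A k. v \<in> e}. g v e)"
proof -
  have "(\<Sum>e\<in>nsets A k. \<Sum>v\<in>e. g v e) = (\<Sum>e\<in>nsets A k. \<Sum>v\<in>{v\<in>A. v \<in> e}. g v e)"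
    by (intro sum.cong) (auto simp: nsets_def intro: sum.cong)
  also have "\<dots> = (\<Sum>v\<in>A. \<Sum>e\<in>{e \<in> nsets A k. v \<in> e}. g v e)"
    using assms by (intro sum.swap_restrict) (auto simp: finite_imp_finite_nsets)
  finally show ?thesis .
qed

text \<open>The quadratic form of the Gram matrix of the incidence map
  \<open>y \<mapsto> (sum y e)\<close>: a diagonal entry counts the k-sets through one point, an
  off-diagonal entry those through two.\<close>

lemma sum_square_nsets:
  fixes y :: "'a \<Rightarrow> real"
  assumes "finite A" "k > 1"
  shows "(\<Sum>e\<in>nsets A k. (sum y e)\<^sup>2) =
    real ((card A - 1) choose (k - 1)) * (\<Sum>v\<in>A. (y v)\<^sup>2)
    + real ((card A - 2) choose (k - 2)) * ((sum y A)\<^sup>2 - (\<Sum>v\<in>A. (y v)\<^sup>2))"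
proof -
  let ?m = "real ((card A - 1) choose (k - 1))" and ?m2 = "real ((card A - 2) choose (k - 2))"
  have "(\<Sum>e\<in>nsets A k. (sum y e)\<^sup>2) = (\<Sum>e\<in>nsets A k. \<Sum>v\<in>e. y v * sum y e)"
    by (simp add: power2_eq_square sum_distrib_right)
  also have "\<dots> = (\<Sum>v\<in>A. \<Sum>e\<in>{e \<in> nsets A k. v \<in> e}. y v * sum y e)"
    by (rule sum_incidence_swap[OF assms(1)])
  \<comment> \<open>Among the k-sets through v, the point v occurs in all of them and every other
    point in \<open>?m2\<close> of them.\<close>
  also have "\<dots> = (\<Sum>v\<in>A. y v * ((?m - ?m2) * y v + ?m2 * sum y A))"
  proof (intro sum.cong refl)
    fix v assume v: "v \<in> A"
    have "(\<Sum>e\<in>{e \<in> nsets A k. v \<in> e}. sum y e)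
        = (\<Sum>e\<in>{e \<in> nsets A k. v \<in> e}. \<Sum>u\<in>{u\<in>A. u \<in> e}. y u)"
      by (intro sum.cong) (auto simp: nsets_def intro: sum.cong)
    also have "\<dots> = (\<Sum>u\<in>A. \<Sum>e\<in>{e \<in> {e \<in> nsets A k. v \<in> e}. u \<in> e}. y u)"
      using assms by (intro sum.swap_restrict) (auto simp: finite_imp_finite_nsets)
    also have "\<dots> = (\<Sum>u\<in>A. y u * real (card {e \<in> nsets A k. u \<in> e \<and> v \<in> e}))"
      by (intro sum.cong refl) (simp add: conj_ac)
    also have "\<dots> = y v * ?m + (\<Sum>u\<in>A-{v}. y u * ?m2)"
      using v assms by (subst sum.remove[OF _ v])
        (auto simp: card_nsets_containing card_nsets_containing_two intro!: sum.cong)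
    also have "\<dots> = (?m - ?m2) * y v + ?m2 * sum y A"
      using v assms(1) by (simp add: sum.remove[of A v y] algebra_simps sum_distrib_right)
    finally show "(\<Sum>e\<in>{e \<in> nsets A k. v \<in> e}. y v * sum y e)
        = y v * ((?m - ?m2) * y v + ?m2 * sum y A)"
      by (metis sum_distrib_left)
  qed
  also have "\<dots> = (?m - ?m2) * (\<Sum>v\<in>A. (y v)\<^sup>2) + ?m2 * (sum y A)\<^sup>2"
    by (simp add: ring_distribs sum.distrib power2_eq_square sum_distrib_left sum_distrib_right
        mult_ac sum_subtractf)
  finally show ?thesis by (simp add: algebra_simps)
qed

section \<open>Minimization over boxes\<close>

text \<open>Outside A an extensional function has the single value \<open>undefined\<close>, so the
  box is a product of compact sets over the whole index type. Tychonoff's theorem makes it compact,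
  and a continuous function attains its infimum.\<close>

lemma box_minimizer:
  fixes f :: "('a \<Rightarrow> real) \<Rightarrow> real"
  assumes "continuous_on UNIV f" "\<And>i. i \<in> A \<Longrightarrow> l i \<le> u i"
  obtains b where "b \<in> (\<Pi>\<^sub>E i\<in>A. {l i..u i})"
    "\<And>b'. b' \<in> (\<Pi>\<^sub>E i\<in>A. {l i..u i}) \<Longrightarrow> f b \<le> f b'"
proof -
  let ?S = "\<lambda>i. if i \<in> A then {l i..u i} else {undefined}"
  have eq: "(\<Pi>\<^sub>E i\<in>A. {l i..u i}) = (\<Pi>\<^sub>E i\<in>UNIV. ?S i)"
    by (auto simp: PiE_def extensional_def Pi_def)
  have "compactin (product_topology (\<lambda>i::'a. euclidean) UNIV) (\<Pi>\<^sub>E i\<in>UNIV. ?S i)"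
    by (subst compactin_PiE) (auto simp: compactin_euclidean_iff)
  hence comp: "compact (\<Pi>\<^sub>E i\<in>A. {l i..u i})"
    by (simp add: eq euclidean_product_topology compactin_euclidean_iff)
  have ne: "(\<Pi>\<^sub>E i\<in>A. {l i..u i}) \<noteq> {}"
    using assms(2) by (subst PiE_eq_empty_iff) fastforce
  show ?thesis
    using continuous_attains_inf[OF comp ne continuous_on_subset[OF assms(1)]] that by blast
qed

text \<open>Common form of two functionals that are minimized over boxes: the negative
  log-likelihood, and the quadratic functional whose stationarity equations are a linear system with
  the Hessian as matrix.\<close>

definition potential ::
    "'a set set \<Rightarrow> ('a set \<Rightarrow> real \<Rightarrow> real) \<Rightarrow> 'a set \<Rightarrow> ('a \<Rightarrow> real) \<Rightarrow> ('a \<Rightarrow> real) \<Rightarrow> real" where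
  "potential E g A a b = (\<Sum>e\<in>E. g e (sum b e)) - (\<Sum>v\<in>A. b v * a v)"

lemma continuous_on_potential:
  assumes "\<And>e. e \<in> E \<Longrightarrow> continuous_on UNIV (g e)"
  shows "continuous_on UNIV (potential E g A a)"
proof -
  have "continuous_on UNIV (\<lambda>b. g e (\<Sum>v\<in>e. b v))" if "e \<in> E" for e
    by (rule continuous_on_compose2[OF assms[OF that]]) (auto intro!: continuous_intros)
  thus ?thesis unfolding potential_def by (auto intro!: continuous_intros)
qed

lemma DERIV_potential:
  assumes "finite A" "finite E" "\<And>e. e \<in> E \<Longrightarrow> finite e" "v \<in> A"
    and g: "\<And>e. e \<in> E \<Longrightarrow> (g e has_real_derivative g' e) (at (sum b e))"
  shows "((\<lambda>t. potential E g A a (b(v := t))) has_real_derivative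
           (\<Sum>e\<in>{e\<in>E. v \<in> e}. g' e) - a v) (at (b v))"
proof -
  have sum_upd: "sum (b(v := t)) e = sum b e + (if v \<in> e then t - b v else 0)" if "finite e" for t e
  proof (cases "v \<in> e")
    case True
    have "sum (b(v := t)) (e - {v}) = sum b (e - {v})" by (intro sum.cong) auto
    thus ?thesis using True that by (simp add: sum.remove[of e v])
  next
    case False
    have "sum (b(v := t)) e = sum b e" using False by (intro sum.cong) auto
    thus ?thesis using False by simp
  qed
  have "((\<lambda>t. g e (sum (b(v := t)) e)) has_real_derivative (if v \<in> e then g' e else 0)) (at (b v))"
    if e: "e \<in> E" for e
  proof (cases "v \<in> e")
    case True
    have "((\<lambda>t. g e (sum b e + (t - b v))) has_real_derivative g' e * 1) (at (b v))"
      by (rule DERIV_chain2[where f = "g e"])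
         (use g[OF e] in \<open>auto intro!: derivative_eq_intros\<close>)
    thus ?thesis using True assms(3)[OF e] by (simp add: sum_upd del: fun_upd_apply)
  next
    case False
    thus ?thesis using assms(3)[OF e] by (simp add: sum_upd del: fun_upd_apply)
  qed
  hence "((\<lambda>t. \<Sum>e\<in>E. g e (sum (b(v := t)) e)) has_real_derivative
       (\<Sum>e\<in>E. if v \<in> e then g' e else 0)) (at (b v))"
    by (rule DERIV_sum)
  moreover have "((\<lambda>t. \<Sum>u\<in>A. (b(v := t)) u * a u) has_real_derivative
       (\<Sum>u\<in>A. if u = v then a u else 0)) (at (b v))"
    by (intro DERIV_sum) (auto intro!: derivative_eq_intros)
  ultimately have "((\<lambda>t. potential E g A a (b(v := t))) has_real_derivative
       (\<Sum>e\<in>E. if v \<in> e then g' e else 0) - (\<Sum>u\<in>A. if u = v then a u else 0)) (at (b v))"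
    unfolding potential_def by (rule DERIV_diff)
  thus ?thesis using assms(1,2,4) by (simp add: sum.inter_filter)
qed

text \<open>If the partial derivative in v were positive while v is above its lower bound, a small
  decrease of this coordinate would stay in the box and lower the potential; the other case is
  symmetric. At a coordinate off both faces the two inequalities combine to the stationarity
  equation.\<close>

lemma potential_box_minimizer_sign:
  assumes "finite A" "finite E" "\<And>e. e \<in> E \<Longrightarrow> finite e" "v \<in> A"
    and g: "\<And>e. e \<in> E \<Longrightarrow> (g e has_real_derivative g' e) (at (sum b e))"
    and b: "b \<in> (\<Pi>\<^sub>E i\<in>A. {l i..u i})"
    and min: "\<And>b'. b' \<in> (\<Pi>\<^sub>E i\<in>A. {l i..u i}) \<Longrightarrow> potential E g A a b \<le> potential E g A a b'"
  shows "l v < b v \<Longrightarrow> (\<Sum>e\<in>{e\<in>E. v \<in> e}. g' e) \<le> a v"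
    and "b v < u v \<Longrightarrow> (\<Sum>e\<in>{e\<in>E. v \<in> e}. g' e) \<ge> a v"
proof -
  let ?D = "(\<Sum>e\<in>{e\<in>E. v \<in> e}. g' e) - a v"
  let ?f = "\<lambda>t. potential E g A a (b(v := t))"
  have D: "(?f has_real_derivative ?D) (at (b v))"
    by (rule DERIV_potential[OF assms(1-5)])
  have mem: "b(v := t) \<in> (\<Pi>\<^sub>E i\<in>A. {l i..u i})" if "l v \<le> t" "t \<le> u v" for t
    using b that \<open>v \<in> A\<close> by (auto simp: PiE_def Pi_def extensional_def)
  have bv: "l v \<le> b v" "b v \<le> u v" using b \<open>v \<in> A\<close> by (auto simp: PiE_def Pi_def)
  have le: "?f (b v) \<le> ?f t" if "l v \<le> t" "t \<le> u v" for t
    using min[OF mem[OF that]] by simp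
  show "(\<Sum>e\<in>{e\<in>E. v \<in> e}. g' e) \<le> a v" if "l v < b v"
  proof (rule ccontr)
    assume "\<not> ?thesis"
    then obtain d where d: "d > 0" "\<forall>h>0. h < d \<longrightarrow> ?f (b v - h) < ?f (b v)"
      using DERIV_pos_inc_left[OF D] by auto
    \<comment> \<open>Halving d keeps the step strictly below d, and the distance to the face keeps
      the moved point in the box.\<close>
    define h where "h = min (d/2) (b v - l v)"
    have "h > 0" "h < d" "l v \<le> b v - h" "b v - h \<le> u v"
      using d that bv by (auto simp: h_def)
    with d le[of "b v - h"] show False by fastforce
  qed
  show "(\<Sum>e\<in>{e\<in>E. v \<in> e}. g' e) \<ge> a v" if "b v < u v"
  proof (rule ccontr)
    assume "\<not> ?thesis"
    then obtain d where d: "d > 0" "\<forall>h>0. h < d \<longrightarrow> ?f (b v) > ?f (b v + h)"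
      using DERIV_neg_dec_right[OF D] by auto
    define h where "h = min (d/2) (u v - b v)"
    have "h > 0" "h < d" "l v \<le> b v + h" "b v + h \<le> u v"
      using d that bv by (auto simp: h_def)
    with d le[of "b v + h"] show False by fastforce
  qed
qed

section \<open>The maximum likelihood estimate of one layer\<close>

text \<open>The condition \<open>2 * s \<le> n\<close>, true for all large n, gives
  \<open>m2 \<le> m / 2\<close>, from which the incidence form gets its coercivity.\<close>

locale beta_layer =
  fixes n s :: nat and M :: real and \<theta> :: "nat \<Rightarrow> real"
  assumes two_le_s: "2 \<le> s" and two_s_le_n: "2 * s \<le> n" and M_pos: "0 < M"
    and \<theta>_bound: "\<And>v. v \<in> {1..n} \<Longrightarrow> \<bar>\<theta> v\<bar> \<le> M"
begin

definition V :: "nat set" where "V = {1..n}"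
definition E :: "nat set set" where "E = nsets {1..n} s"
definition star :: "nat \<Rightarrow> nat set set" where "star v = {e \<in> E. v \<in> e}"
definition m :: real where "m = real ((n - 1) choose (s - 1))"
definition m2 :: real where "m2 = real ((n - 2) choose (s - 2))"
text \<open>Bounds the edge sums of all parameters in the unit box around \<theta>; correspondingly
  \<open>\<kappa>\<close> is a lower bound for \<open>logistic_density\<close> at all these
  sums.\<close>

definition R :: real where "R = real s * (M + 1)"
definition \<kappa> :: real where "\<kappa> = exp (- R) / 4"
definition prob :: "nat set \<Rightarrow> real" where "prob e = logistic (sum \<theta> e)"
definition weight :: "nat set \<Rightarrow> real" where "weight e = logistic_density (sum \<theta> e)"
definition l1 :: "(nat \<Rightarrow> real) \<Rightarrow> real" where "l1 y = (\<Sum>v\<in>V. \<bar>y v\<bar>)"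

lemma finite_V [simp]: "finite V" and finite_E [simp]: "finite E"
  and card_V [simp]: "card V = n"
  by (simp_all add: V_def E_def finite_imp_finite_nsets)

lemma finite_star [simp]: "finite (star v)"
  by (simp add: star_def)

lemma E_D: assumes "e \<in> E" shows "finite e" "card e = s" "e \<subseteq> V"
  using assms by (auto simp: E_def nsets_def V_def)

lemma star_D: "e \<in> star v \<Longrightarrow> e \<in> E \<and> v \<in> e"
  by (simp add: star_def)

lemma E_eq: "E = nsets V s"
  by (simp add: E_def V_def)

lemma \<kappa>_pos: "\<kappa> > 0" and \<kappa>_le: "\<kappa> \<le> 1"
proof -
  have "exp (-R) \<le> 1" using M_pos by (simp add: R_def)
  thus "\<kappa> \<le> 1" unfolding \<kappa>_def by linarith
qed (simp add: \<kappa>_def)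

lemma card_star: "v \<in> V \<Longrightarrow> real (card (star v)) = m"
  using card_nsets_containing[of V v s] two_le_s by (simp add: star_def E_eq m_def)

lemma card_star_Int: "u \<in> V \<Longrightarrow> v \<in> V \<Longrightarrow> u \<noteq> v \<Longrightarrow> real (card (star u \<inter> star v)) = m2"
  using card_nsets_containing_two[of V u v s] two_le_s
  by (simp add: star_def E_eq m2_def Collect_conj_eq[symmetric] conj_ac Int_def)

lemma m2_nonneg: "m2 \<ge> 0" by (simp add: m2_def)

lemma m_ge: "m \<ge> real n - 1"
proof -
  have "(n - 1) choose 1 \<le> (n - 1) choose (s - 1)"
    using two_le_s two_s_le_n by (intro binomial_mono) auto
  thus ?thesis using two_s_le_n two_le_s by (simp add: m_def)
qed

lemma m_pos: "m > 0"
  using m_ge two_s_le_n two_le_s by linarith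

lemma n_ge: "n \<ge> 4" using two_s_le_n two_le_s by linarith

text \<open>The ratio of \<open>m2\<close> to \<open>m\<close> is (s - 1) / (n - 1). This factor of
  order 1/n is what makes the interaction of two given nodes negligible throughout.\<close>

lemma absorption: "real (n - 1) * m2 = real (s - 1) * m"
proof -
  have "(s - 1) * ((n - 1) choose (s - 1)) = (n - 1) * ((n - 2) choose (s - 2))"
    using binomial_absorption[of "s - 2" "n - 1"] two_le_s n_ge
    by (simp add: numeral_2_eq_2 Suc_diff_Suc)
  hence "real ((s - 1) * ((n - 1) choose (s - 1))) = real ((n - 1) * ((n - 2) choose (s - 2)))" by simp
  thus ?thesis unfolding m_def m2_def of_nat_mult by simp
qed

lemma m2_le_half: "m2 \<le> m / 2"
proof -
  have "2 * real (s - 1) \<le> real (n - 1)" using two_s_le_n two_le_s by simp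
  hence "2 * real (s - 1) * m \<le> real (n - 1) * m" using m_pos by (intro mult_right_mono) auto
  hence "real (n - 1) * (2 * m2) \<le> real (n - 1) * m" using absorption by linarith
  thus ?thesis using n_ge by simp
qed

lemma n_m2_le: "real n * m2 \<le> 2 * real s * m"
proof -
  have "real n * m2 \<le> 2 * real (n - 1) * m2"
    using n_ge m2_nonneg by (intro mult_right_mono) auto
  also have "\<dots> = 2 * real (s - 1) * m" using absorption by simp
  also have "\<dots> \<le> 2 * real s * m" using m_pos by (intro mult_right_mono) auto
  finally show ?thesis .
qed

lemma sum_star_swap: "(\<Sum>e\<in>E. \<Sum>v\<in>e. g v e) = (\<Sum>v\<in>V. \<Sum>e\<in>star v. g v e)"
  unfolding E_eq star_def by (rule sum_incidence_swap) simp

text \<open>The transpose of the incidence map sums an edge function over stars; this is the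
  adjointness relation, used to pass between sums over hyperedges and sums over nodes.\<close>

lemma sum_weighted_swap: "(\<Sum>e\<in>E. c e * sum y e) = (\<Sum>v\<in>V. y v * (\<Sum>e\<in>star v. c e))" for c :: "nat set \<Rightarrow> real"
proof -
  have "(\<Sum>e\<in>E. c e * sum y e) = (\<Sum>e\<in>E. \<Sum>v\<in>e. y v * c e)"
    by (simp add: sum_distrib_left mult_ac)
  also have "\<dots> = (\<Sum>v\<in>V. \<Sum>e\<in>star v. y v * c e)" by (rule sum_star_swap)
  finally show ?thesis by (simp add: sum_distrib_left)
qed

text \<open>The Gram matrix is (m - m2) times the identity plus m2 times the all-ones matrix. The
  second part is positive semidefinite and the first dominates m / 2 times the identity.\<close>

lemma sum_square_ge: "(\<Sum>e\<in>E. (sum y e)\<^sup>2) \<ge> m / 2 * (\<Sum>v\<in>V. (y v)\<^sup>2)"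
proof -
  have "(\<Sum>e\<in>E. (sum y e)\<^sup>2) = m * (\<Sum>v\<in>V. (y v)\<^sup>2) + m2 * ((sum y V)\<^sup>2 - (\<Sum>v\<in>V. (y v)\<^sup>2))"
    using sum_square_nsets[of V s y] two_le_s by (simp add: E_eq m_def m2_def)
  also have "\<dots> = (m - m2) * (\<Sum>v\<in>V. (y v)\<^sup>2) + m2 * (sum y V)\<^sup>2"
    by (simp add: algebra_simps)
  also have "\<dots> \<ge> m / 2 * (\<Sum>v\<in>V. (y v)\<^sup>2) + 0"
    using m2_le_half m2_nonneg by (intro add_mono mult_right_mono) (auto intro: sum_nonneg)
  finally show ?thesis by simp
qed

lemma l1_nonneg: "l1 y \<ge> 0" by (simp add: l1_def sum_nonneg)

lemma abs_le_l1: "v \<in> V \<Longrightarrow> \<bar>y v\<bar> \<le> l1 y"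
  unfolding l1_def by (rule member_le_sum) auto

lemma l1_square_le: "(l1 y)\<^sup>2 \<le> real n * (\<Sum>v\<in>V. (y v)\<^sup>2)"
  using sum_squared_le_sum_of_squares[of "\<lambda>v. \<bar>y v\<bar>" V] by (simp add: l1_def mult_ac)

text \<open>Coercivity bounds the sum of squares and Cauchy-Schwarz turns it into the square of the
  l1-norm at the cost of a factor n; one power of the norm then cancels against the right-hand
  side.\<close>

lemma l1_bound:
  assumes "c * (\<Sum>e\<in>E. (sum y e)\<^sup>2) \<le> A * l1 y" "c > 0" "A \<ge> 0"
  shows "l1 y \<le> 2 * real n * A / (c * m)"
proof (cases "l1 y = 0")
  case True
  thus ?thesis using assms m_pos by simp
next
  case False
  hence pos: "l1 y > 0" using l1_nonneg[of y] by linarith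
  have "c * m * (l1 y)\<^sup>2 \<le> c * m * (real n * (\<Sum>v\<in>V. (y v)\<^sup>2))"
    using assms m_pos by (intro mult_left_mono l1_square_le) auto
  also have "\<dots> = 2 * real n * (c * (m / 2 * (\<Sum>v\<in>V. (y v)\<^sup>2)))" by simp
  also have "\<dots> \<le> 2 * real n * (c * (\<Sum>e\<in>E. (sum y e)\<^sup>2))"
    using assms by (intro mult_left_mono sum_square_ge) auto
  also have "\<dots> \<le> 2 * real n * (A * l1 y)" using assms by (intro mult_left_mono) auto
  finally have "(c * m * l1 y) * l1 y \<le> (2 * real n * A) * l1 y" by (simp add: power2_eq_square mult_ac)
  hence "c * m * l1 y \<le> 2 * real n * A" using pos by simp
  thus ?thesis using assms m_pos by (simp add: field_simps)
qed

text \<open>Injectivity of the incidence map, a consequence of coercivity; the uniqueness of the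
  minimizer rests on it.\<close>

lemma sum_eq_0_imp:
  fixes y :: "nat \<Rightarrow> real"
  assumes "\<And>e. e \<in> E \<Longrightarrow> sum y e = 0" "v \<in> V"
  shows "y v = 0"
proof -
  have "m / 2 * (\<Sum>v\<in>V. (y v)\<^sup>2) \<le> 0" using sum_square_ge[of y] assms(1) by simp
  hence "(\<Sum>v\<in>V. (y v)\<^sup>2) \<le> 0" using m_pos by (simp add: mult_le_0_iff)
  hence "(\<Sum>v\<in>V. (y v)\<^sup>2) = 0" by (intro antisym sum_nonneg) auto
  thus ?thesis using assms(2) by (subst (asm) sum_nonneg_eq_0_iff) auto
qed

lemma sum_abs_le:
  assumes "e \<in> E" "\<And>v. v \<in> V \<Longrightarrow> \<bar>y v\<bar> \<le> C"
  shows "\<bar>sum y e\<bar> \<le> real s * C"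
proof -
  have "\<bar>sum y e\<bar> \<le> (\<Sum>v\<in>e. \<bar>y v\<bar>)" by (rule sum_abs)
  also have "\<dots> \<le> (\<Sum>v\<in>e. C)" using E_D[OF assms(1)] assms(2) by (intro sum_mono) auto
  finally show ?thesis using E_D[OF assms(1)] by simp
qed

lemma sum_\<theta>_le: "e \<in> E \<Longrightarrow> \<bar>sum \<theta> e\<bar> \<le> R"
  using sum_abs_le[of e \<theta> "M + 1"] \<theta>_bound unfolding R_def V_def by (smt (verit))

lemma weight_ge: "e \<in> E \<Longrightarrow> \<kappa> \<le> weight e"
  unfolding \<kappa>_def weight_def by (intro logistic_density_ge sum_\<theta>_le)

lemma weight_bounds: "0 < weight e" "weight e \<le> 1/4"
  unfolding weight_def by (rule logistic_density_pos, rule logistic_density_le)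

text \<open>Every node other than v lies in \<open>m2\<close> hyperedges of the star of v. The star
  thus sees the remaining coordinates only through \<open>m2\<close> times their l1-norm, which lets
  an l1-bound yield a supremum bound.\<close>

lemma sum_l1_others_le:
  assumes "v \<in> V"
  shows "(\<Sum>e\<in>star v. \<Sum>u\<in>e - {v}. \<bar>y u\<bar>) \<le> m2 * l1 y"
proof -
  have "(\<Sum>e\<in>star v. \<Sum>u\<in>e - {v}. \<bar>y u\<bar>) = (\<Sum>e\<in>star v. \<Sum>u\<in>{u\<in>V - {v}. u \<in> e}. \<bar>y u\<bar>)"
    by (intro sum.cong refl) (auto dest!: star_D E_D)
  also have "\<dots> = (\<Sum>u\<in>V - {v}. \<Sum>e\<in>{e\<in>star v. u \<in> e}. \<bar>y u\<bar>)"
    by (intro sum.swap_restrict) auto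
  also have "\<dots> = (\<Sum>u\<in>V - {v}. real (card (star u \<inter> star v)) * \<bar>y u\<bar>)"
  proof (intro sum.cong refl)
    fix u assume "u \<in> V - {v}"
    have "{e\<in>star v. u \<in> e} = star u \<inter> star v" by (auto simp: star_def)
    thus "(\<Sum>e\<in>{e\<in>star v. u \<in> e}. \<bar>y u\<bar>) = real (card (star u \<inter> star v)) * \<bar>y u\<bar>" by simp
  qed
  also have "\<dots> = (\<Sum>u\<in>V - {v}. m2 * \<bar>y u\<bar>)"
    using assms by (intro sum.cong refl) (auto simp: card_star_Int)
  also have "\<dots> \<le> (\<Sum>u\<in>V. m2 * \<bar>y u\<bar>)" by (intro sum_mono2) (auto simp: m2_nonneg)
  finally show ?thesis by (simp add: l1_def sum_distrib_left)
qed

section \<open>Location and uniqueness of the minimizer\<close>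

definition resid :: "(nat \<Rightarrow> real) \<Rightarrow> nat \<Rightarrow> real" where
  "resid d v = d v - (\<Sum>e\<in>star v. prob e)"

text \<open>Like \<open>resid\<close>, this takes an arbitrary real vector d in the place of the
  degrees, which keeps the analysis of the minimizer deterministic. For the observed degrees,
  \<open>resid\<close> is the centred degree.\<close>

definition neg_lik :: "(nat \<Rightarrow> real) \<Rightarrow> (nat \<Rightarrow> real) \<Rightarrow> real" where
  "neg_lik = potential E (\<lambda>e t. ln (1 + exp t)) V"

text \<open>Of the two summands, 1 stands for the residual bound K itself and
  \<open>8 * real s / \<kappa>\<close> for the influence of the other coordinates, bounded through
  the l1-norm; the outer division by \<open>\<kappa>\<close> comes from the slope in the coordinate
  considered.\<close>

definition C1 :: real where "C1 = (1 + 8 * real s / \<kappa>) / \<kappa>"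

lemma C1_pos: "C1 > 0"
  using \<kappa>_pos by (simp add: C1_def add_pos_nonneg)

lemma neg_lik_restrict: "neg_lik d (restrict b V) = neg_lik d b"
proof -
  have "sum (restrict b V) e = sum b e" if "e \<in> E" for e
    using E_D[OF that] by (intro sum.cong) auto
  thus ?thesis unfolding neg_lik_def potential_def by (intro arg_cong2[of _ _ _ _ "(-)"] sum.cong) auto
qed

text \<open>Strong convexity is summed over the hyperedges. The linear terms collect to the gradient
  at \<theta>, which is the negative of \<open>resid d\<close>.\<close>

lemma neg_lik_diff_ge:
  assumes b: "\<And>e. e \<in> E \<Longrightarrow> \<bar>sum b e\<bar> \<le> R"
  shows "neg_lik d b - neg_lik d \<theta> \<ge>
    \<kappa> / 2 * (\<Sum>e\<in>E. (sum (\<lambda>v. b v - \<theta> v) e)\<^sup>2) - (\<Sum>v\<in>V. (b v - \<theta> v) * resid d v)"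
proof -
  let ?y = "\<lambda>v. b v - \<theta> v"
  have "(\<Sum>e\<in>E. prob e * sum ?y e + \<kappa> / 2 * (sum ?y e)\<^sup>2)
      \<le> (\<Sum>e\<in>E. ln (1 + exp (sum b e)) - ln (1 + exp (sum \<theta> e)))"
  proof (intro sum_mono)
    fix e assume e: "e \<in> E"
    show "prob e * sum ?y e + \<kappa> / 2 * (sum ?y e)\<^sup>2 \<le> ln (1 + exp (sum b e)) - ln (1 + exp (sum \<theta> e))"
      using softplus_ge_quadratic[OF sum_\<theta>_le[OF e] b[OF e]]
      by (simp add: \<kappa>_def prob_def sum_subtractf)
  qed
  moreover have "(\<Sum>e\<in>E. prob e * sum ?y e) = (\<Sum>v\<in>V. ?y v * (\<Sum>e\<in>star v. prob e))"
    by (rule sum_weighted_swap)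
  moreover have "neg_lik d b - neg_lik d \<theta> =
      (\<Sum>e\<in>E. ln (1 + exp (sum b e)) - ln (1 + exp (sum \<theta> e))) - (\<Sum>v\<in>V. ?y v * d v)"
    by (simp add: neg_lik_def potential_def sum_subtractf left_diff_distrib)
  ultimately show ?thesis
    by (simp add: resid_def sum.distrib sum_subtractf right_diff_distrib sum_distrib_left)
qed

text \<open>The edge sum is moved in two stages. Changing coordinate v alone keeps it within R, so
  the slope is at least \<open>\<kappa>\<close>; changing the other coordinates afterwards costs at
  most a quarter of their total change.\<close>

lemma logistic_coordinate_ge:
  assumes v: "v \<in> V" and e: "e \<in> star v" and y: "\<bar>y v\<bar> \<le> 1"
  shows "\<kappa> * \<bar>y v\<bar> - (\<Sum>u\<in>e-{v}. \<bar>y u\<bar>)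
    \<le> sgn (y v) * (logistic (sum \<theta> e + sum y e) - prob e)"
proof -
  have e': "e \<in> E" "v \<in> e" "finite e" using star_D[OF e] E_D by auto
  define r where "r = sum y (e - {v})"
  have split: "sum y e = y v + r" using e' by (simp add: r_def sum.remove[of e v])
  have r: "\<bar>r\<bar> \<le> (\<Sum>u\<in>e-{v}. \<bar>y u\<bar>)" unfolding r_def by (rule sum_abs)
  have th: "\<bar>sum \<theta> e\<bar> \<le> real s * M"
    using sum_abs_le[OF e'(1)] \<theta>_bound by (simp add: V_def)
  have thv: "\<bar>sum \<theta> e + y v\<bar> \<le> R"
    using th y two_le_s by (simp add: R_def algebra_simps)
  have 1: "\<bar>logistic (sum \<theta> e + sum y e) - logistic (sum \<theta> e + y v)\<bar> \<le> \<bar>r\<bar> / 4"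
    using logistic_diff_abs_le[of "sum \<theta> e + sum y e" "sum \<theta> e + y v"] by (simp add: split)
  have 2: "\<kappa> * \<bar>y v\<bar> \<le> sgn (y v) * (logistic (sum \<theta> e + y v) - prob e)"
  proof (cases "y v \<ge> 0")
    case True
    thus ?thesis
      using logistic_diff_ge[OF sum_\<theta>_le[OF e'(1)] thv]
      by (cases "y v = 0") (auto simp: \<kappa>_def prob_def)
  next
    case False
    thus ?thesis
      using logistic_diff_ge[OF thv sum_\<theta>_le[OF e'(1)]]
      by (auto simp: \<kappa>_def prob_def)
  qed
  have "sgn (y v) * (logistic (sum \<theta> e + sum y e) - prob e)
      = sgn (y v) * (logistic (sum \<theta> e + y v) - prob e)
        + sgn (y v) * (logistic (sum \<theta> e + sum y e) - logistic (sum \<theta> e + y v))"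
    by (simp add: algebra_simps)
  moreover have "\<bar>sgn (y v) * (logistic (sum \<theta> e + sum y e) - logistic (sum \<theta> e + y v))\<bar> \<le> \<bar>r\<bar> / 4"
    using 1 by (auto simp: abs_mult abs_sgn_eq)
  ultimately show ?thesis using 2 r by linarith
qed

lemma coordinate_bound:
  assumes v: "v \<in> V" and y: "\<bar>y v\<bar> \<le> 1"
  shows "m * \<kappa> * \<bar>y v\<bar> - m2 * l1 y
    \<le> sgn (y v) * (\<Sum>e\<in>star v. logistic (sum \<theta> e + sum y e) - prob e)"
proof -
  have "m * \<kappa> * \<bar>y v\<bar> - m2 * l1 y \<le> (\<Sum>e\<in>star v. \<kappa> * \<bar>y v\<bar>) - (\<Sum>e\<in>star v. \<Sum>u\<in>e-{v}. \<bar>y u\<bar>)"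
    using sum_l1_others_le[OF v, of y] card_star[OF v] by simp
  also have "\<dots> \<le> (\<Sum>e\<in>star v. sgn (y v) * (logistic (sum \<theta> e + sum y e) - prob e))"
    unfolding sum_subtractf[symmetric] by (intro sum_mono logistic_coordinate_ge v y)
  finally show ?thesis by (simp add: sum_distrib_left)
qed

text \<open>
  The minimizer over the unit box around \<open>\<theta>\<close> satisfies the sign conditions of
  \<open>potential_box_minimizer_sign\<close> at each coordinate, which already force it into the
  interior of the box.
\<close>

lemma likelihood_equation_solution:
  assumes K: "\<And>v. v \<in> V \<Longrightarrow> \<bar>resid d v\<bar> \<le> K" "C1 * K < m"
  obtains b where "b \<in> extensional V" "\<And>v. v \<in> V \<Longrightarrow> \<bar>b v - \<theta> v\<bar> \<le> C1 * K / m"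
    "\<And>v. v \<in> V \<Longrightarrow> (\<Sum>e\<in>star v. logistic (sum b e)) = d v"
proof -
  have "(1::nat) \<in> V" using n_ge by (auto simp: V_def)
  hence K0: "K \<ge> 0" using K(1)[of 1] by linarith
  let ?B = "\<Pi>\<^sub>E v\<in>V. {\<theta> v - 1..\<theta> v + 1}"
  have "continuous_on UNIV (neg_lik d)"
    unfolding neg_lik_def
    by (intro continuous_on_potential continuous_intros) (auto intro: one_plus_exp_pos)
  then obtain b where b: "b \<in> ?B" "\<And>b'. b' \<in> ?B \<Longrightarrow> neg_lik d b \<le> neg_lik d b'"
    by (rule box_minimizer[where A = V and l = "\<lambda>v. \<theta> v - 1" and u = "\<lambda>v. \<theta> v + 1"]) auto
  define y where "y v = b v - \<theta> v" for v
  have y1: "\<bar>y v\<bar> \<le> 1" if "v \<in> V" for v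
    using b(1) that by (fastforce simp: y_def PiE_def Pi_def abs_le_iff)
  have sum_b: "sum b e = sum \<theta> e + sum y e" for e
    by (simp add: y_def sum_subtractf)
  have bR: "\<bar>sum b e\<bar> \<le> R" if "e \<in> E" for e
    unfolding R_def
  proof (rule sum_abs_le[OF that])
    fix v assume "v \<in> V"
    with y1[of v] \<theta>_bound[of v] show "\<bar>b v\<bar> \<le> M + 1" by (simp add: y_def V_def)
  qed
  \<comment> \<open>\<theta> is compared through its restriction to V, since the box consists of
    extensional functions.\<close>
  have "neg_lik d b \<le> neg_lik d (restrict \<theta> V)" by (rule b(2)) auto
  hence "neg_lik d b - neg_lik d \<theta> \<le> 0" by (simp add: neg_lik_restrict)
  with neg_lik_diff_ge[OF bR, of d]
  have "\<kappa> / 2 * (\<Sum>e\<in>E. (sum y e)\<^sup>2) \<le> (\<Sum>v\<in>V. y v * resid d v)"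
    by (simp add: y_def)
  also have "\<dots> \<le> (\<Sum>v\<in>V. K * \<bar>y v\<bar>)"
  proof (intro sum_mono)
    fix v assume "v \<in> V"
    have "y v * resid d v \<le> \<bar>y v\<bar> * \<bar>resid d v\<bar>" by (simp add: abs_mult[symmetric])
    also have "\<dots> \<le> \<bar>y v\<bar> * K" using K(1)[OF \<open>v \<in> V\<close>] by (intro mult_left_mono) auto
    finally show "y v * resid d v \<le> K * \<bar>y v\<bar>" by (simp add: mult_ac)
  qed
  also have "\<dots> = K * l1 y" by (simp add: l1_def sum_distrib_left)
  finally have "l1 y \<le> 2 * real n * K / (\<kappa> / 2 * m)"
    using \<kappa>_pos K0 by (intro l1_bound) auto
  \<comment> \<open>A single likelihood equation sees the l1-error only with the factor
    \<open>m2\<close>. As \<open>real n * m2\<close> is of order m, this contribution is of order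
    K.\<close>
  hence "m2 * l1 y \<le> m2 * (2 * real n * K / (\<kappa> / 2 * m))" by (intro mult_left_mono m2_nonneg)
  also have "\<dots> = (real n * m2) * (4 * K / (\<kappa> * m))" by (simp add: field_simps)
  also have "\<dots> \<le> (2 * real s * m) * (4 * K / (\<kappa> * m))"
    using K0 \<kappa>_pos m_pos by (intro mult_right_mono n_m2_le) auto
  also have "\<dots> = 8 * real s / \<kappa> * K" using m_pos by (simp add: field_simps)
  finally have m2l1: "m2 * l1 y \<le> 8 * real s / \<kappa> * K" .
  have signs: "-1 < y v \<Longrightarrow> (\<Sum>e\<in>star v. logistic (sum b e)) \<le> d v"
    "y v < 1 \<Longrightarrow> (\<Sum>e\<in>star v. logistic (sum b e)) \<ge> d v" if v: "v \<in> V" for v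
    using potential_box_minimizer_sign[OF finite_V finite_E E_D(1) v DERIV_softplus b(1)
        b(2)[unfolded neg_lik_def], simplified]
    by (auto simp: star_def y_def)
  have bound: "\<bar>y v\<bar> \<le> C1 * K / m" if v: "v \<in> V" for v
  proof -
    \<comment> \<open>Even on a face of the box the available sign condition is the right one: if
      \<open>y v\<close> is positive the lower face is not active, and if it is negative the upper
      face is not.\<close>
    have "sgn (y v) * (\<Sum>e\<in>star v. logistic (sum b e) - prob e) \<le> sgn (y v) * resid d v"
      using signs[OF v] by (cases "y v" "0 :: real" rule: linorder_cases)
        (auto simp: resid_def sum_subtractf)
    also have "\<dots> \<le> \<bar>resid d v\<bar>" by (auto simp: sgn_if)
    also have "\<dots> \<le> K" by (rule K(1)[OF v])
    finally have "sgn (y v) * (\<Sum>e\<in>star v. logistic (sum b e) - prob e) \<le> K" .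
    hence "m * \<kappa> * \<bar>y v\<bar> \<le> K + 8 * real s / \<kappa> * K"
      using coordinate_bound[where y = y, OF v y1[OF v]] m2l1 by (simp add: sum_b)
    also have "\<dots> = \<kappa> * (C1 * K)" using \<kappa>_pos by (simp add: C1_def field_simps)
    finally have "m * \<bar>y v\<bar> \<le> C1 * K" using \<kappa>_pos by (simp add: mult_ac)
    thus ?thesis using m_pos by (simp add: field_simps)
  qed
  \<comment> \<open>By \<open>C1 * K < m\<close> the bound places every coordinate off both faces,
    so both sign conditions hold and give the likelihood equation.\<close>
  have "\<bar>y v\<bar> < 1" if "v \<in> V" for v
    using bound[OF that] K(2) m_pos by (smt (verit) divide_less_eq_1_pos)
  hence "(\<Sum>e\<in>star v. logistic (sum b e)) = d v" if "v \<in> V" for v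
    using signs[OF that] that by (smt (verit))
  thus ?thesis using b(1) bound that[of b] by (auto simp: y_def PiE_def)
qed

text \<open>Convexity puts each edge term above its tangent at b, strictly for some hyperedge
  because the incidence map is injective. By the likelihood equation the tangent terms add up to
  exactly the change of the linear part, so the solution found in the box is a global
  minimizer.\<close>

lemma likelihood_equation_strict_minimizer:
  assumes b: "\<And>v. v \<in> V \<Longrightarrow> (\<Sum>e\<in>star v. logistic (sum b e)) = d v"
    and c: "\<exists>v\<in>V. c v \<noteq> b v"
  shows "neg_lik d b < neg_lik d c"
proof -
  let ?y = "\<lambda>v. c v - b v"
  have "\<exists>e\<in>E. sum ?y e \<noteq> 0" using sum_eq_0_imp[of ?y] c by auto
  hence ex: "\<exists>e\<in>E. sum b e \<noteq> sum c e" by (simp add: sum_subtractf) (metis diff_self)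
  have tangent: "ln (1 + exp (sum b e)) + logistic (sum b e) * (sum c e - sum b e) \<le> ln (1 + exp (sum c e))" for e
    using softplus_gt_tangent[of "sum b e" "sum c e"] by (cases "sum b e = sum c e") auto
  have "(\<Sum>e\<in>E. ln (1 + exp (sum b e)) + logistic (sum b e) * (sum c e - sum b e))
      < (\<Sum>e\<in>E. ln (1 + exp (sum c e)))"
    using ex tangent softplus_gt_tangent by (intro sum_strict_mono_ex1) auto
  moreover have "(\<Sum>e\<in>E. logistic (sum b e) * sum ?y e) = (\<Sum>v\<in>V. ?y v * d v)"
    by (subst sum_weighted_swap) (simp add: b)
  ultimately show ?thesis
    by (simp add: neg_lik_def potential_def sum.distrib sum_subtractf left_diff_distrib)
qed

text \<open>The system is the stationarity condition of a quadratic functional with the Hessian at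
  \<theta>. Comparison with the zero vector and coercivity bound the minimizer over a large box, so
  that it avoids the faces and the first-order conditions are equations.\<close>

lemma linear_system_solvable:
  obtains b where "\<And>u. u \<in> V \<Longrightarrow> (\<Sum>e\<in>star u. weight e * sum b e) = a u"
proof -
  define A where "A = l1 a"
  \<comment> \<open>The l1-bound that coercivity will give for the minimizer, increased by 1 to make
    the inequality strict.\<close>
  define Q where "Q = 4 * real n * A / (\<kappa> * m) + 1"
  have A0: "A \<ge> 0" by (simp add: A_def l1_nonneg)
  have Q: "Q > 0" using A0 \<kappa>_pos m_pos by (simp add: Q_def add_nonneg_pos)
  let ?f = "potential E (\<lambda>e t. weight e / 2 * t\<^sup>2) V a"
  let ?B = "\<Pi>\<^sub>E v\<in>V. {-Q..Q}"
  have "continuous_on UNIV ?f"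
    by (intro continuous_on_potential continuous_intros)
  then obtain b where b: "b \<in> ?B" "\<And>b'. b' \<in> ?B \<Longrightarrow> ?f b \<le> ?f b'"
    by (rule box_minimizer[where A = V and l = "\<lambda>v. -Q" and u = "\<lambda>v. Q"]) (use Q in auto)
  have sum0: "sum (restrict (\<lambda>_. 0) V) e = (0::real)" if "e \<in> E" for e
    using E_D[OF that] by (intro sum.neutral) auto
  have "?f b \<le> ?f (restrict (\<lambda>_. 0) V)" using Q by (intro b(2)) auto
  also have "\<dots> = 0" by (simp add: potential_def sum0 del: restrict_apply) (simp add: restrict_apply)
  finally have "(\<Sum>e\<in>E. weight e / 2 * (sum b e)\<^sup>2) \<le> (\<Sum>v\<in>V. b v * a v)"
    by (simp add: potential_def)
  moreover have "\<kappa> / 2 * (\<Sum>e\<in>E. (sum b e)\<^sup>2) \<le> (\<Sum>e\<in>E. weight e / 2 * (sum b e)\<^sup>2)"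
    unfolding sum_distrib_left using weight_ge by (intro sum_mono mult_right_mono) auto
  moreover have "(\<Sum>v\<in>V. b v * a v) \<le> (\<Sum>v\<in>V. A * \<bar>b v\<bar>)"
  proof (intro sum_mono)
    fix v assume "v \<in> V"
    have "b v * a v \<le> \<bar>b v\<bar> * \<bar>a v\<bar>" by (simp add: abs_mult[symmetric])
    also have "\<dots> \<le> \<bar>b v\<bar> * A" unfolding A_def by (intro mult_left_mono abs_le_l1 \<open>v \<in> V\<close>) auto
    finally show "b v * a v \<le> A * \<bar>b v\<bar>" by (simp add: mult_ac)
  qed
  ultimately have "\<kappa> / 2 * (\<Sum>e\<in>E. (sum b e)\<^sup>2) \<le> A * l1 b"
    by (simp add: l1_def sum_distrib_left)
  hence "l1 b \<le> 2 * real n * A / (\<kappa> / 2 * m)" using \<kappa>_pos A0 by (intro l1_bound) auto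
  hence l1b: "l1 b < Q" by (simp add: Q_def field_simps)
  have "(\<Sum>e\<in>star u. weight e * sum b e) = a u" if u: "u \<in> V" for u
  proof (rule antisym)
    have D: "((\<lambda>t. weight e / 2 * t\<^sup>2) has_real_derivative weight e * sum b e) (at (sum b e))" for e
      by (auto intro!: derivative_eq_intros)
    note signs = potential_box_minimizer_sign[OF finite_V finite_E E_D(1) u D b(1) b(2), simplified]
    have "\<bar>b u\<bar> < Q" using abs_le_l1[OF u, of b] l1b by linarith
    thus "(\<Sum>e\<in>star u. weight e * sum b e) \<le> a u" "a u \<le> (\<Sum>e\<in>star u. weight e * sum b e)"
      using signs by (auto simp: star_def)
  qed
  thus ?thesis using that by blast
qed

section \<open>The correction vector and the first-order expansion\<close>

definition var :: "nat \<Rightarrow> real" where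
  "var v = (\<Sum>e\<in>star v. weight e)"

text \<open>Together with \<open>var v\<close> on the diagonal, these are the entries of row v of
  the Hessian at \<theta>, equivalently of the covariance matrix of the degrees.\<close>

definition offdiag :: "nat \<Rightarrow> nat \<Rightarrow> real" where
  "offdiag v u = (if u = v then 0 else \<Sum>e\<in>star u \<inter> star v. weight e)"

text \<open>
  \<open>corr v\<close> solves the linear system with the Hessian at \<open>\<theta>\<close> as matrix and the off-diagonal part
  of its row \<open>v\<close> as right-hand side. As the Hessian is also the covariance matrix of the degrees,
  pairing with \<open>corr v\<close> turns the cross terms of the likelihood equation at \<open>v\<close> into a linear
  form of small variance.
\<close>

definition corr :: "nat \<Rightarrow> nat \<Rightarrow> real" where
  "corr v = (SOME b. \<forall>u\<in>V. (\<Sum>e\<in>star u. weight e * sum b e) = offdiag v u)"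

lemma corr: "u \<in> V \<Longrightarrow> (\<Sum>e\<in>star u. weight e * sum (corr v) e) = offdiag v u"
proof -
  have "\<exists>b. \<forall>u\<in>V. (\<Sum>e\<in>star u. weight e * sum b e) = offdiag v u"
    using linear_system_solvable[of "offdiag v"] by metis
  from someI_ex[OF this] show "u \<in> V \<Longrightarrow> ?thesis" unfolding corr_def by blast
qed

lemma var_bounds:
  assumes "v \<in> V"
  shows "\<kappa> * m \<le> var v" "var v \<le> m"
proof -
  have "(\<Sum>e\<in>star v. \<kappa>) \<le> var v"
    unfolding var_def by (intro sum_mono weight_ge) (auto dest: star_D)
  thus "\<kappa> * m \<le> var v" using card_star[OF assms] by (simp add: mult_ac)
  have "var v \<le> (\<Sum>e\<in>star v. 1)"
    unfolding var_def using weight_bounds(2) by (intro sum_mono) (smt (verit) divide_le_eq_1)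
  thus "var v \<le> m" using card_star[OF assms] by simp
qed

lemma var_pos: "v \<in> V \<Longrightarrow> var v > 0"
  using var_bounds(1) \<kappa>_pos m_pos by (smt (verit) mult_pos_pos)

lemma offdiag_bounds:
  assumes "v \<in> V" "u \<in> V"
  shows "0 \<le> offdiag v u" "offdiag v u \<le> m2"
proof -
  show "0 \<le> offdiag v u" using weight_bounds(1)[THEN less_imp_le] by (auto simp: offdiag_def intro!: sum_nonneg)
  show "offdiag v u \<le> m2"
  proof (cases "u = v")
    case False
    have "(\<Sum>e\<in>star u \<inter> star v. weight e) \<le> (\<Sum>e\<in>star u \<inter> star v. 1)"
      using weight_bounds(2) by (intro sum_mono) (smt (verit) divide_le_eq_1)
    thus ?thesis using False card_star_Int[OF assms(2,1) False] by (simp add: offdiag_def)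
  qed (simp add: offdiag_def m2_nonneg)
qed

text \<open>Pairing the system that defines \<open>corr v\<close> with \<open>corr v\<close> itself
  turns its Hessian form into a pairing with the right-hand side, whose entries lie between 0 and
  \<open>m2\<close>. The left-hand side will appear as the variance of a linear form in the
  residuals.\<close>

lemma corr_energy_le_l1: "v \<in> V \<Longrightarrow> (\<Sum>e\<in>E. weight e * (sum (corr v) e)\<^sup>2) \<le> m2 * l1 (corr v)"
proof -
  assume v: "v \<in> V"
  have "(\<Sum>e\<in>E. weight e * (sum (corr v) e)\<^sup>2) = (\<Sum>e\<in>E. (weight e * sum (corr v) e) * sum (corr v) e)"
    by (simp add: power2_eq_square mult_ac)
  also have "\<dots> = (\<Sum>u\<in>V. corr v u * offdiag v u)"
    by (subst sum_weighted_swap) (simp add: corr)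
  also have "\<dots> \<le> (\<Sum>u\<in>V. m2 * \<bar>corr v u\<bar>)"
  proof (intro sum_mono)
    fix u assume "u \<in> V"
    have "corr v u * offdiag v u \<le> \<bar>corr v u\<bar> * offdiag v u"
      using offdiag_bounds[OF v \<open>u \<in> V\<close>] by (intro mult_right_mono) auto
    also have "\<dots> \<le> \<bar>corr v u\<bar> * m2"
      using offdiag_bounds[OF v \<open>u \<in> V\<close>] by (intro mult_left_mono) auto
    finally show "corr v u * offdiag v u \<le> m2 * \<bar>corr v u\<bar>" by (simp add: mult_ac)
  qed
  finally show ?thesis by (simp add: l1_def sum_distrib_left)
qed

text \<open>The energy bound is an instance of \<open>l1_bound\<close> with \<open>m2\<close> as A,
  and the resulting factor \<open>real n * m2\<close> is of order m. The bound is therefore uniform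
  in n.\<close>

lemma l1_corr_le:
  assumes v: "v \<in> V"
  shows "l1 (corr v) \<le> 4 * real s / \<kappa>"
proof -
  have "\<kappa> * (\<Sum>e\<in>E. (sum (corr v) e)\<^sup>2) \<le> (\<Sum>e\<in>E. weight e * (sum (corr v) e)\<^sup>2)"
    unfolding sum_distrib_left using weight_ge by (intro sum_mono mult_right_mono) auto
  also have "\<dots> \<le> m2 * l1 (corr v)" by (rule corr_energy_le_l1[OF v])
  finally have "l1 (corr v) \<le> 2 * real n * m2 / (\<kappa> * m)"
    using \<kappa>_pos m2_nonneg by (intro l1_bound) auto
  also have "\<dots> = 2 * (real n * m2) / (\<kappa> * m)" by simp
  also have "\<dots> \<le> 2 * (2 * real s * m) / (\<kappa> * m)"
    using \<kappa>_pos m_pos by (intro divide_right_mono mult_left_mono n_m2_le) auto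
  finally show ?thesis using m_pos by (simp add: field_simps)
qed

lemma corr_energy_le:
  assumes v: "v \<in> V"
  shows "(\<Sum>e\<in>E. weight e * (sum (corr v) e)\<^sup>2) \<le> m2 * (4 * real s / \<kappa>)"
  using corr_energy_le_l1[OF v] mult_left_mono[OF l1_corr_le[OF v] m2_nonneg] by linarith

lemma sum_star_weight:
  assumes v: "v \<in> V"
  shows "(\<Sum>e\<in>star v. weight e * sum y e) = var v * y v + (\<Sum>u\<in>V. y u * offdiag v u)"
proof -
  have "(\<Sum>e\<in>star v. weight e * sum y e) = (\<Sum>e\<in>star v. \<Sum>u\<in>{u\<in>V. u \<in> e}. y u * weight e)"
  proof (intro sum.cong refl)
    fix e assume "e \<in> star v"
    hence "{u\<in>V. u \<in> e} = e" using E_D(3)[of e] star_D by auto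
    thus "weight e * sum y e = (\<Sum>u\<in>{u\<in>V. u \<in> e}. y u * weight e)"
      by (simp add: sum_distrib_right mult_ac)
  qed
  also have "\<dots> = (\<Sum>u\<in>V. \<Sum>e\<in>{e\<in>star v. u \<in> e}. y u * weight e)"
    by (intro sum.swap_restrict) auto
  also have "\<dots> = (\<Sum>u\<in>V. y u * (\<Sum>e\<in>star u \<inter> star v. weight e))"
  proof (intro sum.cong refl)
    fix u
    have "{e\<in>star v. u \<in> e} = star u \<inter> star v" by (auto simp: star_def)
    thus "(\<Sum>e\<in>{e\<in>star v. u \<in> e}. y u * weight e) = y u * (\<Sum>e\<in>star u \<inter> star v. weight e)"
      by (simp add: sum_distrib_left)
  qed
  also have "\<dots> = y v * var v + (\<Sum>u\<in>V - {v}. y u * offdiag v u)"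
    using v by (subst sum.remove[OF _ v]) (auto simp: var_def offdiag_def intro!: sum.cong)
  also have "(\<Sum>u\<in>V - {v}. y u * offdiag v u) = (\<Sum>u\<in>V. y u * offdiag v u)"
    by (intro sum.mono_neutral_left) (auto simp: offdiag_def)
  finally show ?thesis by (simp add: mult_ac)
qed

lemma sum_corr_E_le:
  assumes v: "v \<in> V"
  shows "(\<Sum>e\<in>E. \<bar>sum (corr v) e\<bar>) \<le> m * (4 * real s / \<kappa>)"
proof -
  have "(\<Sum>e\<in>E. \<bar>sum (corr v) e\<bar>) \<le> (\<Sum>e\<in>E. \<Sum>u\<in>e. \<bar>corr v u\<bar>)"
    by (intro sum_mono sum_abs)
  also have "\<dots> = (\<Sum>u\<in>V. \<Sum>e\<in>star u. \<bar>corr v u\<bar>)" by (rule sum_star_swap)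
  also have "\<dots> = m * l1 (corr v)"
    by (simp add: l1_def sum_distrib_left card_star)
  also have "\<dots> \<le> m * (4 * real s / \<kappa>)" using m_pos l1_corr_le[OF v] by (intro mult_left_mono) auto
  finally show ?thesis .
qed

definition C2 :: real where "C2 = (real s)\<^sup>2 * (1 + 4 * real s / \<kappa>)"

text \<open>Each likelihood equation is expanded to first order. In the equation at v the cross
  terms are replaced by residuals with the help of \<open>corr v\<close>, which leaves only
  quadratic remainders: those in the star of v, and those of all hyperedges weighted by
  \<open>corr v\<close>. These are the two summands in \<open>C2\<close>.\<close>

lemma linearization:
  assumes v: "v \<in> V"
    and b: "\<And>u. u \<in> V \<Longrightarrow> (\<Sum>e\<in>star u. logistic (sum b e)) = d u"
    and \<delta>: "\<And>u. u \<in> V \<Longrightarrow> \<bar>b u - \<theta> u\<bar> \<le> \<delta>"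
  shows "\<bar>var v * (b v - \<theta> v) - (resid d v - (\<Sum>u\<in>V. corr v u * resid d u))\<bar> \<le> C2 * m * \<delta>\<^sup>2"
proof -
  define y where "y u = b u - \<theta> u" for u
  define rem where "rem e = logistic (sum b e) - prob e - weight e * sum y e" for e
  have sum_b: "sum b e - sum \<theta> e = sum y e" for e
    by (simp add: y_def sum_subtractf)
  have rem: "\<bar>rem e\<bar> \<le> (real s)\<^sup>2 * \<delta>\<^sup>2" if e: "e \<in> E" for e
  proof -
    have "\<bar>rem e\<bar> \<le> (sum y e)\<^sup>2"
      using logistic_taylor[of "sum b e" "sum \<theta> e"] by (simp add: rem_def prob_def weight_def sum_b)
    also have "\<dots> = \<bar>sum y e\<bar>\<^sup>2" by simp
    also have "\<dots> \<le> (real s * \<delta>)\<^sup>2"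
      using \<delta> by (intro power_mono sum_abs_le[OF e]) (auto simp: y_def)
    finally show ?thesis by (simp add: power_mult_distrib)
  qed
  have eq: "(\<Sum>e\<in>star u. weight e * sum y e) = resid d u - (\<Sum>e\<in>star u. rem e)" if "u \<in> V" for u
    using b[OF that] by (simp add: rem_def resid_def sum_subtractf)
  \<comment> \<open>All expanded equations are paired with \<open>corr v\<close>. The weighted form
    is symmetric in \<open>y\<close> and \<open>corr v\<close>, so the system defining
    \<open>corr v\<close> reproduces exactly the cross terms of the equation at v.\<close>
  have "(\<Sum>u\<in>V. corr v u * (resid d u - (\<Sum>e\<in>star u. rem e)))
      = (\<Sum>u\<in>V. corr v u * (\<Sum>e\<in>star u. weight e * sum y e))"
    by (simp add: eq)
  also have "\<dots> = (\<Sum>e\<in>E. (weight e * sum y e) * sum (corr v) e)"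
    by (rule sum_weighted_swap[symmetric])
  also have "\<dots> = (\<Sum>e\<in>E. (weight e * sum (corr v) e) * sum y e)"
    by (simp add: mult_ac)
  also have "\<dots> = (\<Sum>u\<in>V. y u * offdiag v u)"
    by (subst sum_weighted_swap) (simp add: corr)
  finally have A: "(\<Sum>u\<in>V. y u * offdiag v u)
      = (\<Sum>u\<in>V. corr v u * resid d u) - (\<Sum>e\<in>E. rem e * sum (corr v) e)"
    by (simp add: sum_weighted_swap right_diff_distrib sum_subtractf)
  have B: "var v * y v + (\<Sum>u\<in>V. y u * offdiag v u) = resid d v - (\<Sum>e\<in>star v. rem e)"
    using sum_star_weight[OF v, of y] eq[OF v] by simp
  have "\<bar>\<Sum>e\<in>star v. rem e\<bar> \<le> (\<Sum>e\<in>star v. \<bar>rem e\<bar>)" by (rule sum_abs)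
  also have "\<dots> \<le> (\<Sum>e\<in>star v. (real s)\<^sup>2 * \<delta>\<^sup>2)" by (intro sum_mono rem) (auto dest: star_D)
  also have "\<dots> = (real s)\<^sup>2 * \<delta>\<^sup>2 * m" using card_star[OF v] by simp
  finally have r1: "\<bar>\<Sum>e\<in>star v. rem e\<bar> \<le> (real s)\<^sup>2 * \<delta>\<^sup>2 * m" .
  have "\<bar>\<Sum>e\<in>E. rem e * sum (corr v) e\<bar> \<le> (\<Sum>e\<in>E. \<bar>rem e * sum (corr v) e\<bar>)" by (rule sum_abs)
  also have "\<dots> \<le> (\<Sum>e\<in>E. ((real s)\<^sup>2 * \<delta>\<^sup>2) * \<bar>sum (corr v) e\<bar>)"
    unfolding abs_mult by (intro sum_mono mult_right_mono rem) auto
  also have "\<dots> \<le> ((real s)\<^sup>2 * \<delta>\<^sup>2) * (m * (4 * real s / \<kappa>))"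
    unfolding sum_distrib_left[symmetric] by (intro mult_left_mono sum_corr_E_le v) auto
  finally have r2: "\<bar>\<Sum>e\<in>E. rem e * sum (corr v) e\<bar> \<le> ((real s)\<^sup>2 * \<delta>\<^sup>2) * (m * (4 * real s / \<kappa>))" .
  have "var v * y v - (resid d v - (\<Sum>u\<in>V. corr v u * resid d u))
      = (\<Sum>e\<in>E. rem e * sum (corr v) e) - (\<Sum>e\<in>star v. rem e)"
    using A B by linarith
  also have "\<bar>\<dots>\<bar> \<le> ((real s)\<^sup>2 * \<delta>\<^sup>2) * (m * (4 * real s / \<kappa>)) + (real s)\<^sup>2 * \<delta>\<^sup>2 * m"
    using r1 r2 by linarith
  also have "\<dots> = C2 * m * \<delta>\<^sup>2" by (simp add: C2_def algebra_simps)
  finally show ?thesis by (simp add: y_def)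
qed

section \<open>Plug-in variance, rates and the studentized square\<close>

lemma plugin_var_eq:
  assumes v: "v \<in> V"
  shows "plugin_var n s b v = (\<Sum>e\<in>star v. logistic_density (sum b e))"
proof -
  have "(\<Sum>e\<in>star v. logistic_density (sum b e))
      = (\<Sum>e\<in>nsets (V - {v}) (s - 1). logistic_density (sum b (insert v e)))"
    using bij_betw_insert_nsets[of v V s] v two_le_s
    by (intro sum.reindex_bij_betw[symmetric]) (auto simp: star_def E_eq)
  also have "\<dots> = plugin_var n s b v"
    unfolding plugin_var_def V_def
    by (intro sum.cong refl) (auto simp: logistic_density_def nsets_def subset_Diff_insert)
  finally show ?thesis ..
qed

lemma plugin_var_approx:
  assumes v: "v \<in> V" and \<delta>: "\<And>u. u \<in> V \<Longrightarrow> \<bar>b u - \<theta> u\<bar> \<le> \<delta>"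
  shows "\<bar>plugin_var n s b v - var v\<bar> \<le> m * (real s * \<delta>)"
proof -
  have "\<bar>plugin_var n s b v - var v\<bar>
      = \<bar>\<Sum>e\<in>star v. logistic_density (sum b e) - logistic_density (sum \<theta> e)\<bar>"
    by (simp add: plugin_var_eq[OF v] var_def weight_def sum_subtractf)
  also have "\<dots> \<le> (\<Sum>e\<in>star v. \<bar>logistic_density (sum b e) - logistic_density (sum \<theta> e)\<bar>)"
    by (rule sum_abs)
  also have "\<dots> \<le> (\<Sum>e\<in>star v. real s * \<delta>)"
  proof (intro sum_mono)
    fix e assume "e \<in> star v"
    hence e: "e \<in> E" by (simp add: star_D)
    have "\<bar>logistic_density (sum b e) - logistic_density (sum \<theta> e)\<bar> \<le> \<bar>sum b e - sum \<theta> e\<bar>"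
      by (rule logistic_density_diff_abs_le)
    also have "\<dots> = \<bar>sum (\<lambda>u. b u - \<theta> u) e\<bar>" by (simp add: sum_subtractf)
    also have "\<dots> \<le> real s * \<delta>" by (intro sum_abs_le e \<delta>)
    finally show "\<bar>logistic_density (sum b e) - logistic_density (sum \<theta> e)\<bar> \<le> real s * \<delta>" .
  qed
  finally show ?thesis using card_star[OF v] by simp
qed

text \<open>
  The threshold \<open>K\<close> for the centred degrees has to exceed their standard deviation \<open>sqrt m\<close> by a
  factor \<open>N\<close> tending to infinity, while the deterministic errors, of order \<open>N\<^sup>3 / sqrt m\<close> at worst,
  have to vanish. As \<open>sqrt m \<ge> sqrt n / 2\<close>, the choice \<open>N = n\<^bsup>1/8\<^esup>\<close> leaves room for both.
\<close>

definition N :: real where "N = real n powr (1/8)"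
definition K :: real where "K = sqrt m * N"
definition \<delta> :: real where "\<delta> = C1 * K / m"

lemma N_ge_1: "N \<ge> 1"
  unfolding N_def using n_ge by (intro ge_one_powr_ge_zero) auto

lemma N_pow_8: "N ^ 8 = real n"
  unfolding N_def using n_ge by (simp add: powr_power)

lemma sqrt_m_ge: "sqrt m \<ge> N ^ 4 / 2"
proof -
  have "(N ^ 4 / 2)\<^sup>2 = real n / 4"
    using N_pow_8 by (simp add: power_divide power_mult[symmetric])
  also have "\<dots> \<le> m" using m_ge n_ge by linarith
  finally show ?thesis by (rule real_le_rsqrt)
qed

lemma sqrt_m_pos: "sqrt m > 0" and sqrt_m_sq: "sqrt m * sqrt m = m"
  using m_pos by auto

lemma \<delta>_eq: "\<delta> = C1 * N / sqrt m"
proof -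
  have "\<delta> = C1 * (sqrt m * N) / (sqrt m * sqrt m)" by (simp only: \<delta>_def K_def sqrt_m_sq)
  moreover have "a * (x * b) / (x * x) = a * b / x" if "x > 0" for a b x :: real
    using that by simp
  ultimately show ?thesis using sqrt_m_pos by metis
qed

lemma m_\<delta>_sq: "m * \<delta>\<^sup>2 = (C1 * N)\<^sup>2"
  unfolding \<delta>_eq using m_pos by (simp add: power_divide)

lemma \<delta>_nonneg: "\<delta> \<ge> 0"
  unfolding \<delta>_eq using C1_pos N_ge_1 m_pos by simp

text \<open>In the numerator, 1 comes from the stochastic remainder and
  \<open>2 * C2 * C1\<^sup>2\<close> from the linearization error. In \<open>C4\<close>, the first
  term comes from the plug-in variance and the other two from a difference of squares.\<close>

definition C5 :: real where "C5 = (1 + 2 * C2 * C1\<^sup>2) / sqrt \<kappa>"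
definition C4 :: real where "C4 = 2 * real s * C1 ^ 3 + 2 * C1 * C5 + C5\<^sup>2"

lemma C2_nonneg: "C2 \<ge> 0"
  using \<kappa>_pos by (simp add: C2_def)

lemma C5_nonneg: "C5 \<ge> 0"
  using C2_nonneg \<kappa>_pos by (simp add: C5_def)

text \<open>Both squares are compared with that of w, the error standardized by the true variance.
  The distance of w and z is of order \<open>1 / N\<^sup>2\<close> while w itself is of order N, so
  their squares differ by order 1/N; exchanging plug-in and true variance costs order
  \<open>N ^ 3 / sqrt m\<close>, again at most of order 1/N.\<close>

lemma studentized_square_approx:
  assumes v: "v \<in> V"
    and b: "\<And>u. u \<in> V \<Longrightarrow> (\<Sum>e\<in>star u. logistic (sum b e)) = d u"
    and \<delta>: "\<And>u. u \<in> V \<Longrightarrow> \<bar>b u - \<theta> u\<bar> \<le> \<delta>"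
    and rest: "\<bar>resid d v - (\<Sum>u\<in>V. corr v u * resid d u) - sqrt (var v) * z\<bar> \<le> sqrt m / N\<^sup>2"
  shows "\<bar>plugin_var n s b v * (b v - \<theta> v)\<^sup>2 - z\<^sup>2\<bar> \<le> C4 / N"
proof -
  define y where "y = b v - \<theta> v"
  define w where "w = sqrt (var v) * y"
  note N1 = N_ge_1
  have N4: "1 / sqrt m \<le> 2 / N ^ 4"
    using sqrt_m_ge N1 m_pos by (simp add: field_simps)
  have varpos: "var v > 0" by (rule var_pos[OF v])
  have sk: "sqrt (var v) \<ge> sqrt \<kappa> * sqrt m"
    using var_bounds(1)[OF v] by (metis real_sqrt_le_iff real_sqrt_mult)
  have skpos: "sqrt \<kappa> * sqrt m > 0" using \<kappa>_pos m_pos by simp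
  have C2N: "C2 * C1\<^sup>2 * N\<^sup>2 \<ge> 0" using C2_nonneg by simp
  have "\<bar>sqrt (var v) * (w - z)\<bar> = \<bar>(var v * y - (resid d v - (\<Sum>u\<in>V. corr v u * resid d u)))
      + (resid d v - (\<Sum>u\<in>V. corr v u * resid d u) - sqrt (var v) * z)\<bar>"
    using varpos by (simp add: w_def algebra_simps)
  also have "\<dots> \<le> C2 * m * \<delta>\<^sup>2 + sqrt m / N\<^sup>2"
    using linearization[OF v b \<delta>] rest unfolding y_def by linarith
  also have "C2 * m * \<delta>\<^sup>2 = C2 * C1\<^sup>2 * N\<^sup>2"
    using m_\<delta>_sq by (simp add: power_mult_distrib mult_ac)
  finally have "sqrt (var v) * \<bar>w - z\<bar> \<le> C2 * C1\<^sup>2 * N\<^sup>2 + sqrt m / N\<^sup>2"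
    using varpos by (simp add: abs_mult)
  moreover have "sqrt \<kappa> * sqrt m * \<bar>w - z\<bar> \<le> sqrt (var v) * \<bar>w - z\<bar>"
    using sk by (intro mult_right_mono) auto
  ultimately have "\<bar>w - z\<bar> \<le> (C2 * C1\<^sup>2 * N\<^sup>2 + sqrt m / N\<^sup>2) / (sqrt \<kappa> * sqrt m)"
    using skpos by (simp add: pos_le_divide_eq mult_ac)
  also have "\<dots> = (C2 * C1\<^sup>2 * N\<^sup>2 * (1 / sqrt m) + 1 / N\<^sup>2) / sqrt \<kappa>"
    using m_pos \<kappa>_pos N1 by (simp add: field_simps)
  also have "\<dots> \<le> (C2 * C1\<^sup>2 * N\<^sup>2 * (2 / N ^ 4) + 1 / N\<^sup>2) / sqrt \<kappa>"
    using \<kappa>_pos N4 C2N by (intro divide_right_mono add_right_mono mult_left_mono) auto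
  also have "\<dots> = C5 / N\<^sup>2"
    using N1 by (simp add: C5_def field_simps power2_eq_square power4_eq_xxxx)
  finally have wz: "\<bar>w - z\<bar> \<le> C5 / N\<^sup>2" .
  have yd: "\<bar>y\<bar> \<le> \<delta>" using \<delta>[OF v] by (simp add: y_def)
  have "\<bar>w\<bar> \<le> sqrt m * \<delta>"
    unfolding w_def abs_mult using var_bounds(2)[OF v] yd varpos by (intro mult_mono) auto
  also have "\<dots> = C1 * N" using m_pos by (simp add: \<delta>_eq)
  finally have w: "\<bar>w\<bar> \<le> C1 * N" .
  \<comment> \<open>The second factor w + z is written through w and w - z, for which bounds are at
    hand.\<close>
  have "\<bar>w\<^sup>2 - z\<^sup>2\<bar> = \<bar>w - z\<bar> * \<bar>2 * w - (w - z)\<bar>"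
    by (simp add: abs_mult[symmetric] power2_eq_square algebra_simps)
  also have "\<dots> \<le> (C5 / N\<^sup>2) * (2 * (C1 * N) + C5 / N\<^sup>2)"
    using w wz C5_nonneg by (intro mult_mono) auto
  also have "\<dots> = (2 * C1 * C5) / N + C5\<^sup>2 / N ^ 4"
    using N1 by (simp add: field_simps power2_eq_square power4_eq_xxxx)
  also have "\<dots> \<le> (2 * C1 * C5) / N + C5\<^sup>2 / N"
    using N1 self_le_power[of N 4] by (intro add_left_mono divide_left_mono) auto
  finally have 1: "\<bar>w\<^sup>2 - z\<^sup>2\<bar> \<le> (2 * C1 * C5) / N + C5\<^sup>2 / N" .
  have "plugin_var n s b v * y\<^sup>2 - w\<^sup>2 = (plugin_var n s b v - var v) * y\<^sup>2"
    using varpos by (simp add: w_def power_mult_distrib algebra_simps)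
  hence "\<bar>plugin_var n s b v * y\<^sup>2 - w\<^sup>2\<bar> = \<bar>plugin_var n s b v - var v\<bar> * \<bar>y\<bar>\<^sup>2"
    by (simp add: abs_mult)
  also have "\<dots> \<le> (m * (real s * \<delta>)) * \<delta>\<^sup>2"
    using plugin_var_approx[OF v \<delta>] yd m_pos \<delta>_nonneg by (intro mult_mono power_mono) auto
  also have "\<dots> = real s * \<delta> * (m * \<delta>\<^sup>2)" by simp
  also have "\<dots> = real s * C1 ^ 3 * N ^ 3 * (1 / sqrt m)"
    unfolding m_\<delta>_sq by (simp add: \<delta>_eq power2_eq_square power3_eq_cube)
  also have "\<dots> \<le> real s * C1 ^ 3 * N ^ 3 * (2 / N ^ 4)"
    using N4 N1 C1_pos by (intro mult_left_mono) auto
  also have "\<dots> = 2 * real s * C1 ^ 3 / N"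
    using N1 by (simp add: field_simps power3_eq_cube power4_eq_xxxx)
  finally have 2: "\<bar>plugin_var n s b v * y\<^sup>2 - w\<^sup>2\<bar> \<le> 2 * real s * C1 ^ 3 / N" .
  have "\<bar>plugin_var n s b v * y\<^sup>2 - z\<^sup>2\<bar> \<le> 2 * real s * C1 ^ 3 / N + ((2 * C1 * C5) / N + C5\<^sup>2 / N)"
    using 1 2 by linarith
  also have "\<dots> = C4 / N" by (simp add: C4_def add_divide_distrib)
  finally show ?thesis by (simp add: y_def)
qed

lemma C1_K_less_m:
  assumes "N ^ 3 > 2 * C1"
  shows "C1 * K < m"
proof -
  have "C1 * N < N ^ 3 / 2 * N" using assms N_ge_1 by (intro mult_strict_right_mono) auto
  also have "\<dots> = N ^ 4 / 2" by (simp add: power3_eq_cube power4_eq_xxxx)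
  also have "\<dots> \<le> sqrt m" by (rule sqrt_m_ge)
  finally have "C1 * N * sqrt m < sqrt m * sqrt m" using sqrt_m_pos by (intro mult_strict_right_mono)
  thus ?thesis using m_pos by (simp add: K_def mult_ac)
qed

text \<open>The solution of the likelihood equations in the unit box is a strict minimizer among all
  extensional vectors, hence the unique ML estimate, and it inherits the supremum bound.\<close>

lemma ml_estimate_characterization:
  assumes lik: "\<And>\<beta>. neg_log_lik n s H \<beta> = neg_lik d \<beta>"
    and resid: "\<And>v. v \<in> V \<Longrightarrow> \<bar>resid d v\<bar> \<le> K" and large: "N ^ 3 > 2 * C1"
  shows "\<exists>b. (\<forall>\<beta>. is_ml_estimate n s H \<beta> \<longleftrightarrow> \<beta> = b) \<and>
    (\<forall>v\<in>V. (\<Sum>e\<in>star v. logistic (sum b e)) = d v) \<and> (\<forall>v\<in>V. \<bar>b v - \<theta> v\<bar> \<le> \<delta>)"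
proof -
  obtain b where b: "b \<in> extensional V" "\<And>v. v \<in> V \<Longrightarrow> \<bar>b v - \<theta> v\<bar> \<le> C1 * K / m"
    "\<And>v. v \<in> V \<Longrightarrow> (\<Sum>e\<in>star v. logistic (sum b e)) = d v"
    using likelihood_equation_solution[OF resid C1_K_less_m[OF large]] by metis
  have less: "neg_lik d b < neg_lik d \<beta>" if "\<beta> \<in> extensional V" "\<beta> \<noteq> b" for \<beta>
  proof (rule likelihood_equation_strict_minimizer[OF b(3)])
    show "\<exists>v\<in>V. \<beta> v \<noteq> b v" using extensionalityI[OF that(1) b(1)] that(2) by blast
  qed
  have "is_ml_estimate n s H \<beta> \<longleftrightarrow> \<beta> = b" for \<beta>
    unfolding is_ml_estimate_def is_arg_min_def lik using b(1) less
    by (metis V_def order_less_asym order_less_irrefl)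
  thus ?thesis using b unfolding \<delta>_def by blast
qed

end

section \<open>Independent Bernoulli variables\<close>

lemma norm_iexp_quadratic:
  "cmod (iexp x - (1 + \<i> * x - complex_of_real (x\<^sup>2 / 2))) \<le> \<bar>x\<bar> ^ 3 / 6"
proof -
  have "(\<Sum>k\<le>2. (\<i> * complex_of_real x) ^ k / fact k) = 1 + \<i> * x - complex_of_real (x\<^sup>2 / 2)"
    by (simp add: numeral_2_eq_2 power_mult_distrib)
  thus ?thesis using iexp_approx1[of x 2] by (simp add: numeral_3_eq_3 numeral_2_eq_2)
qed

lemma exp_minus_linear_approx:
  fixes y :: real
  assumes "y \<ge> 0"
  shows "\<bar>exp (- y) - (1 - y)\<bar> \<le> y\<^sup>2"
proof -
  have ge: "exp (- y) \<ge> 1 - y" using exp_ge_add_one_self[of "- y"] by simp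
  have "(1 + y) * exp (- y) \<le> exp y * exp (- y)"
    by (intro mult_right_mono) (auto simp: exp_ge_add_one_self)
  hence "(1 + y) * exp (- y) \<le> 1" by (simp add: exp_minus)
  hence "exp (- y) \<le> 1 / (1 + y)" using assms by (simp add: field_simps)
  also have "\<dots> \<le> 1 - y + y\<^sup>2"
  proof -
    have "(1 - y + y\<^sup>2) * (1 + y) = 1 + y ^ 3" by (simp add: algebra_simps power2_eq_square power3_eq_cube)
    also have "\<dots> \<ge> 1" using assms by simp
    finally show ?thesis using assms by (simp add: field_simps)
  qed
  finally show ?thesis using ge by (simp add: abs_le_iff)
qed

text \<open>A centred Bernoulli variable has mean 0 and variance p (1 - p), so the second-order
  Taylor polynomials at its two values average to 1 minus half of \<open>h\<^sup>2\<close> times the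
  variance. This agrees with the Gaussian factor to second order.\<close>

lemma bernoulli_char_approx:
  fixes p h :: real
  assumes p: "0 < p" "p < 1"
  shows "cmod (iexp (h * (1 - p)) * complex_of_real p + iexp (h * (0 - p)) * complex_of_real (1 - p)
           - complex_of_real (exp (- (h\<^sup>2 * (p * (1 - p)) / 2)))) \<le> \<bar>h\<bar> ^ 3 + h ^ 4"
proof -
  define q where "q x = 1 + \<i> * complex_of_real x - complex_of_real (x\<^sup>2 / 2)" for x :: real
  let ?x = "h * (1 - p)" and ?y = "h * (0 - p)" and ?v = "h\<^sup>2 * (p * (1 - p)) / 2"
  have le: "\<bar>h * c\<bar> ^ 3 / 6 \<le> \<bar>h\<bar> ^ 3" if "\<bar>c\<bar> \<le> 1" for c
  proof -
    have "\<bar>h * c\<bar> ^ 3 \<le> (\<bar>h\<bar> * 1) ^ 3"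
      unfolding abs_mult using that by (intro power_mono mult_left_mono) auto
    moreover have "0 \<le> \<bar>h\<bar> ^ 3" by simp
    ultimately show ?thesis unfolding mult_1_right by linarith
  qed
  have 1: "cmod (iexp ?x - q ?x) \<le> \<bar>h\<bar> ^ 3" "cmod (iexp ?y - q ?y) \<le> \<bar>h\<bar> ^ 3"
    using norm_iexp_quadratic[of ?x] norm_iexp_quadratic[of ?y] le[of "1 - p"] le[of "0 - p"] p
    unfolding q_def by (auto intro: order_trans)
  have 2: "q ?x * complex_of_real p + q ?y * complex_of_real (1 - p) = complex_of_real (1 - ?v)"
    by (simp add: q_def complex_eq_iff) (simp add: field_simps power2_eq_square)
  have p4: "p * (1 - p) \<le> 1" using p by (intro mult_le_one) auto
  have "?v\<^sup>2 \<le> (h\<^sup>2 * 1)\<^sup>2"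
  proof (intro power_mono)
    have "h\<^sup>2 * (p * (1 - p)) \<le> h\<^sup>2 * 1" using p4 by (intro mult_left_mono) auto
    moreover have "0 \<le> h\<^sup>2 * (p * (1 - p))" using p by simp
    ultimately show "?v \<le> h\<^sup>2 * 1" "0 \<le> ?v" by linarith+
  qed
  hence "?v\<^sup>2 \<le> h ^ 4" by simp
  with exp_minus_linear_approx[of ?v] p
  have 3: "\<bar>exp (- ?v) - (1 - ?v)\<bar> \<le> h ^ 4" by simp
  have "cmod (iexp ?x * complex_of_real p + iexp ?y * complex_of_real (1 - p) - complex_of_real (exp (- ?v)))
     = cmod ((iexp ?x - q ?x) * complex_of_real p + (iexp ?y - q ?y) * complex_of_real (1 - p)
         - complex_of_real (exp (- ?v) - (1 - ?v)))"
    by (rule arg_cong[of _ _ cmod], subst of_real_diff, subst 2[symmetric]) (simp add: algebra_simps)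
  also have "\<dots> \<le> cmod (iexp ?x - q ?x) * p + cmod (iexp ?y - q ?y) * (1 - p) + \<bar>exp (- ?v) - (1 - ?v)\<bar>"
    using p by (intro norm_triangle_le_diff add_mono norm_triangle_le)
       (auto simp: norm_mult simp del: of_real_diff of_real_1)
  also have "\<dots> \<le> \<bar>h\<bar> ^ 3 * p + \<bar>h\<bar> ^ 3 * (1 - p) + h ^ 4"
    using 1 3 p by (intro add_mono mult_right_mono) auto
  finally show ?thesis by (simp add: algebra_simps)
qed

locale bernoulli_field =
  fixes I :: "'i set" and p :: "'i \<Rightarrow> real"
  assumes finite_I: "finite I" and p_bounds: "\<And>i. i \<in> I \<Longrightarrow> 0 < p i \<and> p i < 1"
begin

definition P :: "('i \<Rightarrow> bool) pmf" where
  "P = Pi_pmf I False (\<lambda>i. bernoulli_pmf (p i))"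

definition U :: "'i \<Rightarrow> ('i \<Rightarrow> bool) \<Rightarrow> real" where
  "U i \<omega> = of_bool (\<omega> i) - p i"

lemma finite_set_P: "finite (set_pmf P)"
  unfolding P_def
  by (rule finite_subset[OF set_Pi_pmf_subset'[OF finite_I]]) (auto intro: finite_PiE_dflt finite_I)

lemma integrable_P [simp]: "integrable (measure_pmf P) (f :: _ \<Rightarrow> _ :: {banach, second_countable_topology})"
  by (rule integrable_measure_pmf_finite[OF finite_set_P])

lemma expectation_component:
  assumes "i \<in> I"
  shows "measure_pmf.expectation P (\<lambda>\<omega>. f (\<omega> i)) = f True * p i + f False * (1 - p i)"
    and "measure_pmf.expectation P (\<lambda>\<omega>. g (\<omega> i))
      = g True * complex_of_real (p i) + g False * complex_of_real (1 - p i)"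
proof -
  have eq: "map_pmf (\<lambda>\<omega>. \<omega> i) P = bernoulli_pmf (p i)"
    unfolding P_def using assms by (simp add: Pi_pmf_component finite_I)
  have "measure_pmf.expectation P (\<lambda>\<omega>. f (\<omega> i)) = measure_pmf.expectation (map_pmf (\<lambda>\<omega>. \<omega> i) P) f"
    by simp
  thus "measure_pmf.expectation P (\<lambda>\<omega>. f (\<omega> i)) = f True * p i + f False * (1 - p i)"
    unfolding eq using p_bounds[OF assms] by simp
  have "measure_pmf.expectation P (\<lambda>\<omega>. g (\<omega> i)) = measure_pmf.expectation (map_pmf (\<lambda>\<omega>. \<omega> i) P) g"
    by simp
  thus "measure_pmf.expectation P (\<lambda>\<omega>. g (\<omega> i))
      = g True * complex_of_real (p i) + g False * complex_of_real (1 - p i)"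
    unfolding eq using p_bounds[OF assms]
    by (subst (asm) integral_measure_pmf[of UNIV]) (auto simp: UNIV_bool scaleR_conv_of_real mult_ac)
qed

text \<open>Each factor depends only on its own block of coordinates, and disjoint blocks of
  independent coordinates are independent.\<close>

lemma expectation_prod_blocks:
  fixes G :: "'j \<Rightarrow> ('i \<Rightarrow> bool) \<Rightarrow> 'c :: {real_normed_field, banach, second_countable_topology}"
  assumes "finite L" and K: "\<And>j. j \<in> L \<Longrightarrow> K j \<subseteq> I" "disjoint_family_on K L"
    and G: "\<And>j \<omega> \<omega>'. j \<in> L \<Longrightarrow> (\<And>i. i \<in> K j \<Longrightarrow> \<omega> i = \<omega>' i) \<Longrightarrow> G j \<omega> = G j \<omega>'"
  shows "measure_pmf.expectation P (\<lambda>\<omega>. \<Prod>j\<in>L. G j \<omega>) = (\<Prod>j\<in>L. measure_pmf.expectation P (G j))"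
proof -
  have ind: "prob_space.indep_vars (measure_pmf P) (\<lambda>_. count_space UNIV) (\<lambda>i \<omega>. \<omega> i) I"
    unfolding P_def by (rule indep_vars_Pi_pmf[OF finite_I])
  have "prob_space.indep_vars (measure_pmf P) (\<lambda>j. PiM (K j) (\<lambda>_. count_space UNIV))
      (\<lambda>j \<omega>. restrict (\<lambda>i. \<omega> i) (K j)) L"
    by (rule prob_space.indep_vars_restrict[OF measure_pmf.prob_space_axioms ind K])
  hence "prob_space.indep_vars (measure_pmf P) (\<lambda>_. borel)
      (\<lambda>j \<omega>. G j (restrict (\<lambda>i. \<omega> i) (K j))) L"
  proof (rule prob_space.indep_vars_compose2[OF measure_pmf.prob_space_axioms])
    fix j assume "j \<in> L"
    hence "finite (K j)" using K(1) finite_I finite_subset by blast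
    thus "G j \<in> borel_measurable (PiM (K j) (\<lambda>_. count_space UNIV))"
      by (subst count_space_PiM_finite) auto
  qed
  from prob_space.indep_vars_lebesgue_integral[OF measure_pmf.prob_space_axioms \<open>finite L\<close> this]
  have "measure_pmf.expectation P (\<lambda>\<omega>. \<Prod>j\<in>L. G j (restrict (\<lambda>i. \<omega> i) (K j)))
      = (\<Prod>j\<in>L. measure_pmf.expectation P (\<lambda>\<omega>. G j (restrict (\<lambda>i. \<omega> i) (K j))))"
    by simp
  moreover have "G j (restrict (\<lambda>i. \<omega> i) (K j)) = G j \<omega>" if "j \<in> L" for j \<omega>
    by (rule G[OF that]) simp
  ultimately show ?thesis by simp
qed

lemma expectation_U: "i \<in> I \<Longrightarrow> measure_pmf.expectation P (U i) = 0"
  using expectation_component(1)[of i "\<lambda>b. of_bool b - p i"]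
  by (simp add: U_def[abs_def] algebra_simps)

lemma expectation_U_mult:
  assumes "i \<in> I" "j \<in> I"
  shows "measure_pmf.expectation P (\<lambda>\<omega>. U i \<omega> * U j \<omega>) = (if i = j then p i * (1 - p i) else 0)"
proof (cases "i = j")
  case True
  thus ?thesis using expectation_component(1)[of i "\<lambda>b. (of_bool b - p i) * (of_bool b - p i)"] assms
    by (simp add: U_def algebra_simps)
next
  case False
  have "measure_pmf.expectation P (\<lambda>\<omega>. \<Prod>k\<in>{i, j}. U k \<omega>) = (\<Prod>k\<in>{i, j}. measure_pmf.expectation P (U k))"
    using assms by (intro expectation_prod_blocks[where K = "\<lambda>k. {k}"])
      (auto simp: U_def disjoint_family_on_def)
  thus ?thesis using False assms by (simp add: expectation_U)
qed

lemma expectation_linear: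
  assumes "A \<subseteq> I"
  shows "measure_pmf.expectation P (\<lambda>\<omega>. \<Sum>i\<in>A. c i * U i \<omega>) = 0"
  using assms by (subst Bochner_Integration.integral_sum) (auto simp: expectation_U subset_iff)

lemma second_moment_linear:
  assumes "A \<subseteq> I"
  shows "measure_pmf.expectation P (\<lambda>\<omega>. (\<Sum>i\<in>A. c i * U i \<omega>)\<^sup>2) = (\<Sum>i\<in>A. (c i)\<^sup>2 * (p i * (1 - p i)))"
proof -
  have fin: "finite A" using assms finite_I finite_subset by blast
  have "measure_pmf.expectation P (\<lambda>\<omega>. (\<Sum>i\<in>A. c i * U i \<omega>)\<^sup>2)
      = measure_pmf.expectation P (\<lambda>\<omega>. \<Sum>i\<in>A. \<Sum>j\<in>A. (c i * c j) * (U i \<omega> * U j \<omega>))"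
    by (simp add: power2_eq_square sum_product mult_ac)
  also have "\<dots> = (\<Sum>i\<in>A. \<Sum>j\<in>A. (c i * c j) * measure_pmf.expectation P (\<lambda>\<omega>. U i \<omega> * U j \<omega>))"
    by (simp add: Bochner_Integration.integral_sum)
  also have "\<dots> = (\<Sum>i\<in>A. \<Sum>j\<in>A. if i = j then (c i * c j) * (p i * (1 - p i)) else 0)"
    using assms by (intro sum.cong refl) (auto simp: expectation_U_mult subset_iff)
  also have "\<dots> = (\<Sum>i\<in>A. (c i)\<^sup>2 * (p i * (1 - p i)))"
    using fin by (simp add: power2_eq_square)
  finally show ?thesis .
qed

lemma linear_Chebyshev:
  assumes "A \<subseteq> I" "a > 0"
  shows "measure_pmf.prob P {\<omega>. \<bar>\<Sum>i\<in>A. c i * U i \<omega>\<bar> \<ge> a} \<le> (\<Sum>i\<in>A. (c i)\<^sup>2 * (p i * (1 - p i))) / a\<^sup>2"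
proof -
  let ?f = "\<lambda>\<omega>. \<Sum>i\<in>A. c i * U i \<omega>"
  have "measure_pmf.prob P {\<omega>\<in>space (measure_pmf P). \<bar>?f \<omega> - measure_pmf.expectation P ?f\<bar> \<ge> a}
      \<le> measure_pmf.variance P ?f / a\<^sup>2"
    by (rule measure_pmf.Chebyshev_inequality) (use \<open>a > 0\<close> in auto)
  thus ?thesis
    unfolding expectation_linear[OF assms(1)] diff_zero second_moment_linear[OF assms(1)] by simp
qed

lemma sum_U_Hoeffding:
  assumes A: "A \<subseteq> I" "A \<noteq> {}" and "a \<ge> 0"
  shows "measure_pmf.prob P {\<omega>. \<bar>\<Sum>i\<in>A. U i \<omega>\<bar> \<ge> a} \<le> 2 * exp (- 2 * a\<^sup>2 / real (card A))"
proof -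
  have fin: "finite A" using assms finite_I finite_subset by blast
  have "prob_space.indep_vars (measure_pmf P) (\<lambda>_. count_space UNIV) (\<lambda>i \<omega>. \<omega> i) A"
    unfolding P_def by (rule prob_space.indep_vars_subset[OF measure_pmf.prob_space_axioms indep_vars_Pi_pmf[OF finite_I] A(1)])
  hence ind: "prob_space.indep_vars (measure_pmf P) (\<lambda>_. borel) (\<lambda>i \<omega>. of_bool (\<omega> i) - p i :: real) A"
    by (rule prob_space.indep_vars_compose2[OF measure_pmf.prob_space_axioms, where Y = "\<lambda>i b. of_bool b - p i"]) auto
  \<comment> \<open>Every \<open>U i\<close> ranges over an interval of length 1, so the squared
    lengths in Hoeffding's bound add up to \<open>card A\<close>.\<close>
  interpret Hoeffding_ineq "measure_pmf P" A U "\<lambda>i. - p i" "\<lambda>i. 1 - p i"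
      "\<Sum>i\<in>A. measure_pmf.expectation P (U i)"
    using ind by unfold_locales (auto simp: fin U_def[abs_def] split: if_splits)
  have 0: "(\<Sum>i\<in>A. measure_pmf.expectation P (U i)) = 0"
    using A by (intro sum.neutral) (auto simp: expectation_U)
  have "real (card A) > 0" using A fin by (simp add: card_gt_0_iff)
  thus ?thesis using Hoeffding_ineq_abs_ge[OF \<open>a \<ge> 0\<close>] by (simp add: 0)
qed

text \<open>By independence both sides are products of factors of modulus at most 1, and such
  products differ by at most the sum of the differences of their factors. This is a quantitative
  central limit theorem for equal coefficients c.\<close>

lemma char_linear_approx:
  assumes A: "A \<subseteq> I"
  shows "cmod (measure_pmf.expectation P (\<lambda>\<omega>. iexp (t * (\<Sum>i\<in>A. c * U i \<omega>)))
      - complex_of_real (exp (- (t\<^sup>2 * (c\<^sup>2 * (\<Sum>i\<in>A. p i * (1 - p i))) / 2))))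
    \<le> real (card A) * (\<bar>t * c\<bar> ^ 3 + (t * c) ^ 4)"
proof -
  have fin: "finite A" using assms finite_I finite_subset by blast
  define h where "h = t * c"
  have prod: "iexp (t * (\<Sum>i\<in>A. c * U i \<omega>)) = (\<Prod>i\<in>A. iexp (h * U i \<omega>))" for \<omega>
    by (simp add: h_def exp_sum[OF fin, symmetric] sum_distrib_left mult_ac)
  have 1: "measure_pmf.expectation P (\<lambda>\<omega>. iexp (t * (\<Sum>i\<in>A. c * U i \<omega>)))
      = (\<Prod>i\<in>A. measure_pmf.expectation P (\<lambda>\<omega>. iexp (h * U i \<omega>)))"
    unfolding prod using A by (intro expectation_prod_blocks[where K = "\<lambda>i. {i}"] fin)
      (auto simp: U_def disjoint_family_on_def)
  have "exp (- (t\<^sup>2 * (c\<^sup>2 * (\<Sum>i\<in>A. p i * (1 - p i))) / 2)) = exp (\<Sum>i\<in>A. - (h\<^sup>2 * (p i * (1 - p i)) / 2))"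
    by (rule arg_cong[of _ _ exp])
       (simp add: h_def sum_distrib_left sum_negf sum_divide_distrib power_mult_distrib mult_ac)
  hence 2: "complex_of_real (exp (- (t\<^sup>2 * (c\<^sup>2 * (\<Sum>i\<in>A. p i * (1 - p i))) / 2)))
      = (\<Prod>i\<in>A. complex_of_real (exp (- (h\<^sup>2 * (p i * (1 - p i)) / 2))))"
    by (simp only: exp_sum[OF fin] of_real_prod)
  have "cmod (measure_pmf.expectation P (\<lambda>\<omega>. iexp (t * (\<Sum>i\<in>A. c * U i \<omega>)))
      - complex_of_real (exp (- (t\<^sup>2 * (c\<^sup>2 * (\<Sum>i\<in>A. p i * (1 - p i))) / 2))))
    \<le> (\<Sum>i\<in>A. cmod (measure_pmf.expectation P (\<lambda>\<omega>. iexp (h * U i \<omega>))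
        - complex_of_real (exp (- (h\<^sup>2 * (p i * (1 - p i)) / 2)))))"
    unfolding 1 2
  proof (rule norm_prod_diff)
    fix i assume i: "i \<in> A"
    have "cmod (measure_pmf.expectation P (\<lambda>\<omega>. iexp (h * U i \<omega>)))
        \<le> measure_pmf.expectation P (\<lambda>\<omega>. cmod (iexp (h * U i \<omega>)))"
      by (rule integral_norm_bound)
    thus "cmod (measure_pmf.expectation P (\<lambda>\<omega>. iexp (h * U i \<omega>))) \<le> 1" by simp
    have "0 \<le> h\<^sup>2 * (p i * (1 - p i))" using p_bounds[of i] i A by auto
    thus "cmod (complex_of_real (exp (- (h\<^sup>2 * (p i * (1 - p i)) / 2)))) \<le> 1" by simp
  qed
  also have "\<dots> \<le> (\<Sum>i\<in>A. \<bar>h\<bar> ^ 3 + h ^ 4)"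
  proof (intro sum_mono)
    fix i assume "i \<in> A"
    hence i: "i \<in> I" using A by auto
    have "measure_pmf.expectation P (\<lambda>\<omega>. iexp (h * U i \<omega>))
        = iexp (h * (1 - p i)) * complex_of_real (p i) + iexp (h * (0 - p i)) * complex_of_real (1 - p i)"
      using expectation_component(2)[OF i, of "\<lambda>b. iexp (h * (of_bool b - p i))"] by (simp add: U_def)
    thus "cmod (measure_pmf.expectation P (\<lambda>\<omega>. iexp (h * U i \<omega>))
        - complex_of_real (exp (- (h\<^sup>2 * (p i * (1 - p i)) / 2)))) \<le> \<bar>h\<bar> ^ 3 + h ^ 4"
      using bernoulli_char_approx[of "p i" h] p_bounds[OF i] by simp
  qed
  finally show ?thesis by (simp add: h_def)
qed

end

lemma exp_minus_diff_le:
  fixes x y :: real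
  assumes "0 \<le> x" "x \<le> y"
  shows "\<bar>exp (- x) - exp (- y)\<bar> \<le> y - x"
proof -
  have "exp (- x) - exp (- y) = exp (- x) * (1 - exp (- (y - x)))"
    by (simp add: right_diff_distrib flip: exp_add)
  also have "\<dots> \<le> 1 * (y - x)"
    using assms exp_ge_add_one_self[of "x - y"] by (intro mult_mono) (auto simp: algebra_simps)
  finally show ?thesis using assms by simp
qed

section \<open>The chi-squared distribution\<close>

text \<open>The characteristic function of a squared standard normal, left as an integral because
  weak convergence to the normal law gives convergence to it directly.\<close>

abbreviation square_char :: "real \<Rightarrow> complex" where
  "square_char t \<equiv> (LINT x|std_normal_distribution. iexp (t * x\<^sup>2))"

lemma prob_space_std_normal: "prob_space std_normal_distribution"
  by (rule prob_space_normal_density) simp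

lemma product_prob_space_std_normal: "product_prob_space (\<lambda>_ :: nat. std_normal_distribution)"
  by (intro product_prob_spaceI prob_space_std_normal)

lemma real_distribution_chi_squared: "real_distribution (chi_squared k)"
proof -
  interpret product_prob_space "\<lambda>_ :: nat. std_normal_distribution" "{..<k}"
    by (rule product_prob_space_std_normal)
  show ?thesis unfolding chi_squared_def by (rule P.real_distribution_distr) measurable
qed

lemma char_chi_squared: "char (chi_squared k) t = square_char t ^ k"
proof -
  interpret product_prob_space "\<lambda>_ :: nat. std_normal_distribution" "{..<k}"
    by (rule product_prob_space_std_normal)
  have "char (chi_squared k) t =
    (LINT x|PiM {..<k} (\<lambda>_. std_normal_distribution). iexp (t * (\<Sum>i<k. (x i)\<^sup>2)))"
    unfolding chi_squared_def char_def by (subst integral_distr) auto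
  also have "\<dots> = (LINT x|PiM {..<k} (\<lambda>_. std_normal_distribution). (\<Prod>i<k. iexp (t * (x i)\<^sup>2)))"
    by (simp add: exp_sum sum_distrib_left)
  also have "\<dots> = (\<Prod>i<k. square_char t)"
    by (subst product_integral_prod) (auto intro!: finite_measure.integrable_const_bound[where B = 1]
        prob_space.finite_measure prob_space_std_normal)
  finally show ?thesis by simp
qed

text \<open>By Fubini the last coordinate is integrated first. Once the others are fixed, its square
  is determined, so it takes at most two values, and these form a null set.\<close>

lemma chi_squared_no_atom:
  assumes "k > 0"
  shows "measure (chi_squared k) {x} = 0"
proof -
  interpret product_prob_space "\<lambda>_ :: nat. std_normal_distribution" "{..<k}"
    by (rule product_prob_space_std_normal)
  obtain k' where k': "k = Suc k'" using assms by (cases k) auto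
  let ?M = "\<lambda>A. (\<Pi>\<^sub>M i\<in>A. std_normal_distribution)"
  let ?S = "{y \<in> space (?M {..<k}). (\<Sum>i<k. (y i)\<^sup>2) = x}"
  have S: "?S \<in> sets (?M {..<k})" by measurable
  have "emeasure (chi_squared k) {x} = emeasure (?M {..<k}) ?S"
    unfolding chi_squared_def
    by (subst emeasure_distr) (auto intro!: arg_cong2[of _ _ _ _ emeasure])
  also have "\<dots> = (\<integral>\<^sup>+ y. indicator ?S y \<partial>?M (insert k' {..<k'}))"
    using S by (simp add: k' lessThan_Suc)
  also have "\<dots> = (\<integral>\<^sup>+ y. (\<integral>\<^sup>+ z. indicator ?S (y(k' := z)) \<partial>std_normal_distribution) \<partial>?M {..<k'})"
    using S by (intro product_nn_integral_insert) (auto simp: k' lessThan_Suc)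
  also have "\<dots> = (\<integral>\<^sup>+ y. 0 \<partial>?M {..<k'})"
  proof (intro nn_integral_cong)
    fix y
    let ?c = "x - (\<Sum>i<k'. (y i)\<^sup>2)"
    have "(\<integral>\<^sup>+ z. indicator ?S (y(k' := z)) \<partial>std_normal_distribution)
        \<le> (\<integral>\<^sup>+ z. indicator {sqrt ?c, - sqrt ?c} z \<partial>std_normal_distribution)"
    proof (intro nn_integral_mono)
      fix z
      have "z \<in> {sqrt ?c, - sqrt ?c}" if "y(k' := z) \<in> ?S"
      proof -
        have "z\<^sup>2 = ?c" using that by (simp add: k')
        hence "sqrt ?c = \<bar>z\<bar>" by (metis real_sqrt_abs)
        thus ?thesis by auto
      qed
      thus "indicator ?S (y(k' := z)) \<le> (indicator {sqrt ?c, - sqrt ?c} z :: ennreal)"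
        by (auto simp: indicator_def)
    qed
    also have "\<dots> = emeasure std_normal_distribution {sqrt ?c, - sqrt ?c}"
      by (intro nn_integral_indicator) auto
    also have "\<dots> = 0"
      by (subst emeasure_density) (auto intro!: nn_integral_null_set finite_imp_null_set_lborel)
    finally show "(\<integral>\<^sup>+ z. indicator ?S (y(k' := z)) \<partial>std_normal_distribution) = 0" by simp
  qed
  finally show ?thesis by (simp add: measure_def)
qed

lemma isCont_cdf_chi_squared:
  assumes "k > 0"
  shows "isCont (cdf (chi_squared k)) x"
proof -
  interpret real_distribution "chi_squared k" by (rule real_distribution_chi_squared)
  show ?thesis using chi_squared_no_atom[OF assms] by (simp add: isCont_cdf)
qed

text \<open>Continuity makes \<open>{x. p \<le> cdf \<mu> x}\<close> closed, so it contains its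
  infimum. To the left of the infimum the cdf is below p, and continuity carries this bound over to
  the limit.\<close>

lemma cdf_quantile:
  assumes \<mu>: "real_distribution \<mu>" and cont: "\<And>x. isCont (cdf \<mu>) x" and p: "0 < p" "p < 1"
  shows "cdf \<mu> (quantile \<mu> p) = p"
proof -
  interpret real_distribution \<mu> by fact
  let ?S = "{x. p \<le> cdf \<mu> x}"
  have "eventually (\<lambda>x. p < cdf \<mu> x) at_top"
    using order_tendstoD(1)[OF cdf_lim_at_top_prob] p by auto
  then obtain b where b: "p < cdf \<mu> b" by (auto simp: eventually_at_top_linorder)
  have "eventually (\<lambda>x. cdf \<mu> x < p) at_bot"
    using order_tendstoD(2)[OF cdf_lim_at_bot] p by auto
  then obtain a where a: "cdf \<mu> a < p" by (auto simp: eventually_at_bot_linorder)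
  have lb: "a \<le> x" if "x \<in> ?S" for x
    using that a cdf_nondecreasing[of x a] by (cases "a \<le> x") auto
  have closed: "closed ?S"
    using cont by (intro closed_Collect_le continuous_at_imp_continuous_on) auto
  have "quantile \<mu> p \<in> ?S"
    unfolding quantile_def
    using closed b lb by (intro closed_contains_Inf) (auto intro: less_imp_le simp: bdd_below_def)
  moreover have "cdf \<mu> (quantile \<mu> p) \<le> p"
  proof -
    have "((cdf \<mu>) \<longlongrightarrow> cdf \<mu> (quantile \<mu> p)) (at_left (quantile \<mu> p))"
      using cont[of "quantile \<mu> p"] by (simp add: isCont_def filterlim_at_split)
    moreover have "eventually (\<lambda>x. cdf \<mu> x \<le> p) (at_left (quantile \<mu> p))"
    proof (rule eventually_at_leftI)
      fix x assume "x \<in> {quantile \<mu> p - 1<..<quantile \<mu> p}"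
      hence "x \<notin> ?S" using lb unfolding quantile_def
        by (metis (no_types, lifting) bdd_belowI cInf_lower greaterThanLessThan_iff not_less)
      thus "cdf \<mu> x \<le> p" by simp
    qed auto
    ultimately show ?thesis by (intro tendsto_upperbound) auto
  qed
  ultimately show ?thesis by auto
qed

section \<open>Stochastic approximation of one layer\<close>

text \<open>The index set I may hold the hyperedges of all layers, with E as the part of size s. All
  layers then share one probability space, as independence across layers requires.\<close>

locale beta_layer_field = beta_layer n s M \<theta> + bernoulli_field I p
  for n s :: nat and M :: real and \<theta> :: "nat \<Rightarrow> real" and I :: "nat set set" and p :: "nat set \<Rightarrow> real" +
  assumes E_eq_layer: "E = {e \<in> I. card e = s}" and p_eq: "\<And>e. e \<in> E \<Longrightarrow> p e = prob e"
begin

lemma E_subset: "E \<subseteq> I" by (auto simp: E_eq_layer)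

definition deg :: "(nat set \<Rightarrow> bool) \<Rightarrow> nat \<Rightarrow> real" where
  "deg \<omega> v = (\<Sum>e\<in>star v. of_bool (\<omega> e))"

lemma star_subset: "star v \<subseteq> E" by (auto simp: star_def)

lemma star_subset_I: "star v \<subseteq> I" using star_subset E_subset by auto

lemma p_variance: "e \<in> E \<Longrightarrow> p e * (1 - p e) = weight e"
  by (simp add: p_eq prob_def weight_def logistic_density_eq)

lemma resid_deg: "resid (deg \<omega>) v = (\<Sum>e\<in>star v. U e \<omega>)"
proof -
  have "(\<Sum>e\<in>star v. U e \<omega>) = (\<Sum>e\<in>star v. of_bool (\<omega> e) - prob e)"
    by (intro sum.cong refl) (use star_subset[of v] p_eq in \<open>auto simp: U_def\<close>)
  thus ?thesis by (simp add: resid_def deg_def sum_subtractf)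
qed

text \<open>Hoeffding's inequality at a single node, where the threshold K makes the exponent
  \<open>- 2 * N\<^sup>2\<close>, and a union bound over the n = \<open>N ^ 8\<close> nodes.\<close>

lemma resid_tail:
  "measure_pmf.prob P {\<omega>. \<not> (\<forall>v\<in>V. \<bar>resid (deg \<omega>) v\<bar> \<le> K)} \<le> 2 * (N ^ 8 * exp (- 2 * N\<^sup>2))"
proof -
  have "measure_pmf.prob P {\<omega>. \<not> (\<forall>v\<in>V. \<bar>resid (deg \<omega>) v\<bar> \<le> K)}
      \<le> measure_pmf.prob P (\<Union>v\<in>V. {\<omega>. \<bar>\<Sum>e\<in>star v. U e \<omega>\<bar> \<ge> K})"
    by (intro measure_pmf.finite_measure_mono) (auto simp: resid_deg)
  also have "\<dots> \<le> (\<Sum>v\<in>V. measure_pmf.prob P {\<omega>. \<bar>\<Sum>e\<in>star v. U e \<omega>\<bar> \<ge> K})"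
    by (intro measure_pmf.finite_measure_subadditive_finite) auto
  also have "\<dots> \<le> (\<Sum>v\<in>V. 2 * exp (- 2 * N\<^sup>2))"
  proof (intro sum_mono)
    fix v assume v: "v \<in> V"
    have K: "K\<^sup>2 / m = N\<^sup>2" "K \<ge> 0" using m_pos N_ge_1 by (auto simp: K_def power_mult_distrib)
    have "star v \<noteq> {}" using card_star[OF v] m_pos by auto
    from sum_U_Hoeffding[OF star_subset_I this K(2)]
    show "measure_pmf.prob P {\<omega>. \<bar>\<Sum>e\<in>star v. U e \<omega>\<bar> \<ge> K} \<le> 2 * exp (- 2 * N\<^sup>2)"
      by (simp add: card_star[OF v] K(1)[symmetric])
  qed
  finally show ?thesis using N_pow_8 by simp
qed

section \<open>Independent approximations of the centred degrees\<close>

definition own :: "nat set \<Rightarrow> nat \<Rightarrow> nat set set" where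
  "own J v = {e \<in> star v. e \<inter> J = {v}}"

text \<open>For distinct v in J the sets \<open>own J v\<close> are disjoint, which makes these
  variables independent. The normalization is by the full \<open>var v\<close>; the variance lost on
  the shared hyperedges is of order \<open>m2\<close> only.\<close>

definition Z :: "nat set \<Rightarrow> nat \<Rightarrow> (nat set \<Rightarrow> bool) \<Rightarrow> real" where
  "Z J v \<omega> = (\<Sum>e\<in>own J v. (1 / sqrt (var v)) * U e \<omega>)"

lemma own_subset: "own J v \<subseteq> star v" by (auto simp: own_def)

lemma card_shared_le:
  assumes v: "v \<in> J" and J: "J \<subseteq> V"
  shows "real (card (star v - own J v)) \<le> real (card J) * m2"
proof -
  have fin: "finite J" using J finite_V finite_subset by blast
  have "star v - own J v \<subseteq> (\<Union>u\<in>J - {v}. star u \<inter> star v)"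
    using v by (auto simp: own_def star_def)
  hence "card (star v - own J v) \<le> card (\<Union>u\<in>J - {v}. star u \<inter> star v)"
    using fin by (intro card_mono) auto
  also have "\<dots> \<le> (\<Sum>u\<in>J - {v}. card (star u \<inter> star v))"
    using fin by (intro card_UN_le) auto
  finally have "real (card (star v - own J v)) \<le> (\<Sum>u\<in>J - {v}. real (card (star u \<inter> star v)))"
    by (metis of_nat_le_iff of_nat_sum)
  also have "\<dots> = (\<Sum>u\<in>J - {v}. m2)"
    using v J by (intro sum.cong refl card_star_Int) auto
  also have "\<dots> \<le> (\<Sum>u\<in>J. m2)" using fin m2_nonneg by (intro sum_mono2) auto
  finally show ?thesis by simp
qed

definition C3 :: "nat \<Rightarrow> real" where "C3 a = 2 * real s * (2 * real a + 2 * (4 * real s / \<kappa>))"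

text \<open>The remainder is a single linear form in the centred indicators. Its variance is of
  order \<open>m2\<close>, by the count of shared hyperedges and by the energy bound for
  \<open>corr v\<close>, so Chebyshev's inequality applies at a level far above its standard
  deviation.\<close>

lemma remainder_tail:
  assumes v: "v \<in> J" and J: "J \<subseteq> V"
  shows "measure_pmf.prob P {\<omega>. \<bar>resid (deg \<omega>) v - (\<Sum>u\<in>V. corr v u * resid (deg \<omega>) u)
      - sqrt (var v) * Z J v \<omega>\<bar> \<ge> sqrt m / N\<^sup>2} \<le> C3 (card J) / N ^ 4"
proof -
  have vV: "v \<in> V" using v J by auto
  \<comment> \<open>The indicator accounts for the shared hyperedges removed from \<open>Z\<close>,
    the other term for the correction, rewritten as a sum over hyperedges.\<close>
  define c where "c e = of_bool (e \<in> star v - own J v) - sum (corr v) e" for e :: "nat set"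
  have eq: "resid (deg \<omega>) v - (\<Sum>u\<in>V. corr v u * resid (deg \<omega>) u) - sqrt (var v) * Z J v \<omega>
      = (\<Sum>e\<in>E. c e * U e \<omega>)" for \<omega>
  proof -
    have "(\<Sum>e\<in>E. c e * U e \<omega>) = (\<Sum>e\<in>E. of_bool (e \<in> star v - own J v) * U e \<omega>)
        - (\<Sum>e\<in>E. U e \<omega> * sum (corr v) e)"
      by (simp only: c_def left_diff_distrib sum_subtractf) (simp add: mult_ac)
    also have "(\<Sum>e\<in>E. U e \<omega> * sum (corr v) e) = (\<Sum>u\<in>V. corr v u * resid (deg \<omega>) u)"
      by (simp add: sum_weighted_swap resid_deg)
    also have "(\<Sum>e\<in>E. of_bool (e \<in> star v - own J v) * U e \<omega>) = (\<Sum>e\<in>star v - own J v. U e \<omega>)"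
      using star_subset by (intro sum.mono_neutral_cong_right) auto
    also have "\<dots> = (\<Sum>e\<in>star v. U e \<omega>) - (\<Sum>e\<in>own J v. U e \<omega>)"
      using own_subset by (intro sum_diff) auto
    also have "(\<Sum>e\<in>own J v. U e \<omega>) = sqrt (var v) * Z J v \<omega>"
      using var_pos[OF vV] by (simp add: Z_def sum_distrib_left)
    finally show ?thesis by (simp add: resid_deg)
  qed
  have "(\<Sum>e\<in>E. (c e)\<^sup>2 * (p e * (1 - p e)))
      \<le> (\<Sum>e\<in>E. 2 * of_bool (e \<in> star v - own J v) + 2 * (weight e * (sum (corr v) e)\<^sup>2))"
  proof (intro sum_mono)
    fix e assume e: "e \<in> E"
    let ?i = "of_bool (e \<in> star v - own J v) :: real"
    have "(c e)\<^sup>2 \<le> 2 * ?i\<^sup>2 + 2 * (sum (corr v) e)\<^sup>2"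
      using sum_squares_bound[of ?i "- sum (corr v) e"] unfolding c_def
      by (simp add: power2_eq_square algebra_simps)
    hence "(c e)\<^sup>2 * weight e \<le> (2 * ?i\<^sup>2 + 2 * (sum (corr v) e)\<^sup>2) * weight e"
      using weight_bounds(1)[of e] by (intro mult_right_mono) auto
    also have "\<dots> = 2 * (?i * weight e) + 2 * (weight e * (sum (corr v) e)\<^sup>2)"
      by (simp add: algebra_simps)
    also have "?i * weight e \<le> ?i * 1" using weight_bounds(2)[of e] by (intro mult_left_mono) auto
    finally show "(c e)\<^sup>2 * (p e * (1 - p e)) \<le> 2 * ?i + 2 * (weight e * (sum (corr v) e)\<^sup>2)"
      using p_variance[OF e] by simp
  qed
  also have "\<dots> = 2 * real (card (star v - own J v)) + 2 * (\<Sum>e\<in>E. weight e * (sum (corr v) e)\<^sup>2)"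
  proof -
    have "(\<Sum>e\<in>E. of_bool (e \<in> star v - own J v)) = (\<Sum>e\<in>star v - own J v. 1 :: real)"
      using star_subset by (intro sum.mono_neutral_cong_right) auto
    thus ?thesis by (simp add: sum.distrib sum_distrib_left[symmetric])
  qed
  also have "\<dots> \<le> 2 * (real (card J) * m2) + 2 * (m2 * (4 * real s / \<kappa>))"
    by (intro add_mono mult_left_mono card_shared_le v J corr_energy_le vV) auto
  also have "\<dots> = m2 * (2 * real (card J) + 2 * (4 * real s / \<kappa>))" by (simp add: algebra_simps)
  finally have second: "(\<Sum>e\<in>E. (c e)\<^sup>2 * (p e * (1 - p e))) \<le> m2 * (2 * real (card J) + 2 * (4 * real s / \<kappa>))" .
  have "measure_pmf.prob P {\<omega>. \<bar>\<Sum>e\<in>E. c e * U e \<omega>\<bar> \<ge> sqrt m / N\<^sup>2}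
      \<le> (\<Sum>e\<in>E. (c e)\<^sup>2 * (p e * (1 - p e))) / (sqrt m / N\<^sup>2)\<^sup>2"
    using m_pos N_ge_1 by (intro linear_Chebyshev E_subset) auto
  also have "\<dots> \<le> m2 * (2 * real (card J) + 2 * (4 * real s / \<kappa>)) / (sqrt m / N\<^sup>2)\<^sup>2"
    by (intro divide_right_mono second) auto
  \<comment> \<open>Inserting n = \<open>N ^ 8\<close> trades \<open>m2\<close> for a multiple of
    \<open>m / N ^ 8\<close>.\<close>
  also have "\<dots> = (real n * m2) * (2 * real (card J) + 2 * (4 * real s / \<kappa>)) * (1 / (m * N ^ 4))"
    using m_pos N_ge_1 by (simp add: N_pow_8[symmetric] field_simps power_divide power_mult[symmetric] flip: power_add)
  also have "\<dots> \<le> (2 * real s * m) * (2 * real (card J) + 2 * (4 * real s / \<kappa>)) * (1 / (m * N ^ 4))"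
    using \<kappa>_pos m_pos N_ge_1 by (intro mult_right_mono n_m2_le) auto
  also have "\<dots> = C3 (card J) / N ^ 4" using m_pos by (simp add: C3_def)
  finally show ?thesis by (simp add: eq)
qed

text \<open>Two comparisons: with the normal law of the exact variance \<open>\<sigma>2\<close> of
  \<open>Z\<close>, and of that law with the standard one. The defect \<open>1 - \<sigma>2\<close>
  is the relative weight of the shared hyperedges, of order m2/m.\<close>

lemma char_Z_approx:
  assumes v: "v \<in> J" and J: "J \<subseteq> V"
  shows "cmod (measure_pmf.expectation P (\<lambda>\<omega>. iexp (t * Z J v \<omega>)) - complex_of_real (exp (- (t\<^sup>2) / 2)))
    \<le> ((2 * \<bar>t\<bar> ^ 3 + 2 * t ^ 4) / \<kappa>\<^sup>2 + 2 * real s * real (card J) * t\<^sup>2 / \<kappa>) / N ^ 4"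
proof -
  have vV: "v \<in> V" using v J by auto
  define c where "c = 1 / sqrt (var v)"
  define \<sigma>2 where "\<sigma>2 = c\<^sup>2 * (\<Sum>e\<in>own J v. p e * (1 - p e))"
  note vp = var_pos[OF vV]
  have cpos: "c > 0" using vp by (simp add: c_def)
  have c2: "c\<^sup>2 = 1 / var v" using vp by (simp add: c_def power_divide)
  have c2_le: "c\<^sup>2 \<le> 1 / (\<kappa> * m)"
    unfolding c2 using var_bounds(1)[OF vV] \<kappa>_pos m_pos vp by (intro divide_left_mono) auto
  have m1: "m \<ge> 1" using m_ge n_ge by linarith
  have sm: "1 / sqrt m \<le> 2 / N ^ 4" using sqrt_m_ge N_ge_1 m_pos by (simp add: field_simps)
  have sm1: "1 / m \<le> 1 / sqrt m" using m1
    by (intro divide_left_mono) (auto intro: real_le_lsqrt simp: self_le_power)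
  \<comment> \<open>Since \<open>\<kappa> \<le> 1\<close>, the square root of
    \<open>\<kappa>\<close> may be replaced by \<open>\<kappa>\<close> in the denominator.\<close>
  have c_le: "c \<le> 1 / (\<kappa> * sqrt m)"
  proof (rule power2_le_imp_le)
    have "\<kappa> * \<kappa> * m \<le> \<kappa> * 1 * m" using \<kappa>_pos \<kappa>_le m_pos by (intro mult_right_mono mult_left_mono) auto
    hence "1 / (\<kappa> * m) \<le> 1 / (\<kappa> * \<kappa> * m)" using \<kappa>_pos m_pos by (intro divide_left_mono) auto
    also have "\<dots> = (1 / (\<kappa> * sqrt m))\<^sup>2" using m_pos by (simp add: power_divide power_mult_distrib power2_eq_square)
    finally show "c\<^sup>2 \<le> (1 / (\<kappa> * sqrt m))\<^sup>2" using c2_le by linarith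
  qed (use \<kappa>_pos m_pos in auto)
  have mc3: "m * c ^ 3 \<le> 2 / N ^ 4 / \<kappa>\<^sup>2"
  proof -
    have "m * c ^ 3 = m * (c\<^sup>2 * c)" by (simp add: power3_eq_cube power2_eq_square)
    also have "\<dots> \<le> m * (1 / (\<kappa> * m) * (1 / (\<kappa> * sqrt m)))"
      using c2_le c_le cpos m_pos \<kappa>_pos by (intro mult_left_mono mult_mono) auto
    also have "\<dots> = (1 / sqrt m) / \<kappa>\<^sup>2" using m_pos \<kappa>_pos by (simp add: power2_eq_square)
    also have "\<dots> \<le> 2 / N ^ 4 / \<kappa>\<^sup>2" using sm by (intro divide_right_mono) auto
    finally show ?thesis .
  qed
  have mc4: "m * c ^ 4 \<le> 2 / N ^ 4 / \<kappa>\<^sup>2"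
  proof -
    have "m * c ^ 4 = m * (c\<^sup>2 * c\<^sup>2)" by (simp add: power4_eq_xxxx power2_eq_square)
    also have "\<dots> \<le> m * (1 / (\<kappa> * m) * (1 / (\<kappa> * m)))"
      using c2_le m_pos \<kappa>_pos by (intro mult_left_mono mult_mono) auto
    also have "\<dots> = (1 / m) / \<kappa>\<^sup>2" using m_pos \<kappa>_pos by (simp add: power2_eq_square)
    also have "\<dots> \<le> 2 / N ^ 4 / \<kappa>\<^sup>2" using sm sm1 by (intro divide_right_mono) auto
    finally show ?thesis .
  qed
  have sum_own: "(\<Sum>e\<in>own J v. p e * (1 - p e)) = (\<Sum>e\<in>own J v. weight e)"
    using own_subset[of J v] star_subset[of v] by (intro sum.cong refl p_variance) auto
  have "var v = (\<Sum>e\<in>own J v. weight e) + (\<Sum>e\<in>star v - own J v. weight e)"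
    unfolding var_def using own_subset by (subst sum.subset_diff[of "own J v"]) auto
  hence diff: "1 - \<sigma>2 = c\<^sup>2 * (\<Sum>e\<in>star v - own J v. weight e)"
    unfolding \<sigma>2_def sum_own c2 using vp by (simp add: field_simps)
  have "(\<Sum>e\<in>star v - own J v. weight e) \<le> (\<Sum>e\<in>star v - own J v. 1)"
    using weight_bounds(2) by (intro sum_mono) (smt (verit) divide_le_eq_1)
  also have "\<dots> \<le> real (card J) * m2" using card_shared_le[OF v J] by simp
  finally have "1 - \<sigma>2 \<le> 1 / (\<kappa> * m) * (real (card J) * m2)"
    unfolding diff using c2_le \<kappa>_pos m_pos weight_bounds(1)[THEN less_imp_le]
    by (intro mult_mono) (auto intro: sum_nonneg)
  also have "\<dots> = (real n * m2) * (real (card J) / (\<kappa> * m * N ^ 8))"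
    using N_ge_1 by (simp add: N_pow_8[symmetric])
  also have "\<dots> \<le> (2 * real s * m) * (real (card J) / (\<kappa> * m * N ^ 8))"
    using \<kappa>_pos m_pos N_ge_1 by (intro mult_right_mono n_m2_le) auto
  also have "\<dots> = 2 * real s * real (card J) / \<kappa> / N ^ 8" using m_pos by simp
  also have "\<dots> \<le> 2 * real s * real (card J) / \<kappa> / N ^ 4"
    using \<kappa>_pos N_ge_1 by (intro divide_left_mono power_increasing) auto
  finally have s1: "1 - \<sigma>2 \<le> 2 * real s * real (card J) / \<kappa> / N ^ 4" .
  have s0: "1 - \<sigma>2 \<ge> 0"
    unfolding diff using weight_bounds(1)[THEN less_imp_le] by (intro mult_nonneg_nonneg sum_nonneg) auto
  have s2: "\<sigma>2 \<ge> 0"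
    unfolding \<sigma>2_def sum_own using weight_bounds(1)[THEN less_imp_le] by (intro mult_nonneg_nonneg sum_nonneg) auto
  have "card (own J v) \<le> card (star v)" using own_subset by (intro card_mono) auto
  hence card_le: "real (card (own J v)) \<le> m" using card_star[OF vV] by linarith
  have "cmod (measure_pmf.expectation P (\<lambda>\<omega>. iexp (t * Z J v \<omega>)) - complex_of_real (exp (- (t\<^sup>2 * \<sigma>2 / 2))))
      \<le> real (card (own J v)) * (\<bar>t * c\<bar> ^ 3 + (t * c) ^ 4)"
    unfolding \<sigma>2_def Z_def c_def[symmetric]
    by (rule char_linear_approx) (use own_subset star_subset_I in blast)
  also have "\<dots> \<le> m * (\<bar>t * c\<bar> ^ 3 + (t * c) ^ 4)" by (intro mult_right_mono card_le) auto
  also have "\<dots> = \<bar>t\<bar> ^ 3 * (m * c ^ 3) + t ^ 4 * (m * c ^ 4)"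
    using cpos by (simp add: abs_mult power_mult_distrib algebra_simps)
  also have "\<dots> \<le> \<bar>t\<bar> ^ 3 * (2 / N ^ 4 / \<kappa>\<^sup>2) + t ^ 4 * (2 / N ^ 4 / \<kappa>\<^sup>2)"
    by (intro add_mono mult_left_mono mc3 mc4) auto
  also have "\<dots> = (2 * \<bar>t\<bar> ^ 3 + 2 * t ^ 4) / \<kappa>\<^sup>2 / N ^ 4" by (simp add: add_divide_distrib mult_ac)
  finally have A: "cmod (measure_pmf.expectation P (\<lambda>\<omega>. iexp (t * Z J v \<omega>)) - complex_of_real (exp (- (t\<^sup>2 * \<sigma>2 / 2))))
      \<le> (2 * \<bar>t\<bar> ^ 3 + 2 * t ^ 4) / \<kappa>\<^sup>2 / N ^ 4" .
  have "\<bar>exp (- (t\<^sup>2 * \<sigma>2 / 2)) - exp (- (t\<^sup>2) / 2)\<bar> \<le> t\<^sup>2 * (1 - \<sigma>2)"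
  proof -
    have nn: "0 \<le> t\<^sup>2 * (1 - \<sigma>2)" using s0 by simp
    have "\<bar>exp (- (t\<^sup>2 * \<sigma>2 / 2)) - exp (- (t\<^sup>2 / 2))\<bar> \<le> t\<^sup>2 / 2 - t\<^sup>2 * \<sigma>2 / 2"
      using s2 nn by (intro exp_minus_diff_le) (auto simp: algebra_simps)
    also have "\<dots> = t\<^sup>2 * (1 - \<sigma>2) / 2" by (simp add: algebra_simps)
    finally show ?thesis using nn by simp
  qed
  also have "\<dots> \<le> t\<^sup>2 * (2 * real s * real (card J) / \<kappa> / N ^ 4)" by (intro mult_left_mono s1) auto
  finally have B: "cmod (complex_of_real (exp (- (t\<^sup>2 * \<sigma>2 / 2))) - complex_of_real (exp (- (t\<^sup>2) / 2)))
      \<le> t\<^sup>2 * (2 * real s * real (card J) / \<kappa> / N ^ 4)"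
    by (metis norm_of_real of_real_diff)
  have "cmod (measure_pmf.expectation P (\<lambda>\<omega>. iexp (t * Z J v \<omega>)) - complex_of_real (exp (- (t\<^sup>2) / 2)))
      \<le> (2 * \<bar>t\<bar> ^ 3 + 2 * t ^ 4) / \<kappa>\<^sup>2 / N ^ 4 + t\<^sup>2 * (2 * real s * real (card J) / \<kappa> / N ^ 4)"
    using norm_diff_triangle_le[OF A B] .
  also have "\<dots> = ((2 * \<bar>t\<bar> ^ 3 + 2 * t ^ 4) / \<kappa>\<^sup>2 + 2 * real s * real (card J) * t\<^sup>2 / \<kappa>) / N ^ 4"
    by (simp add: add_divide_distrib)
  finally show ?thesis .
qed

lemma neg_log_lik_eq: "neg_log_lik n s {e \<in> I. \<omega> e} \<beta> = neg_lik (deg \<omega>) \<beta>"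
proof -
  have "real (sdegree s {e \<in> I. \<omega> e} v) = deg \<omega> v" for v
  proof -
    have "{e \<in> {e \<in> I. \<omega> e}. card e = s \<and> v \<in> e} = {e \<in> star v. \<omega> e}"
      by (auto simp: star_def E_eq_layer)
    thus ?thesis by (simp add: sdegree_def deg_def of_bool_def sum.If_cases Int_def)
  qed
  thus ?thesis by (simp add: neg_log_lik_def neg_lik_def potential_def E_def V_def)
qed

text \<open>Two exceptional events are excluded: some centred degree above K, or a large remainder
  at v. Elsewhere the ML estimate exists uniquely, the estimator must return it, and the
  deterministic approximation applies; the arbitrary values of \<open>est\<close> are confined to
  the exceptional events.\<close>

lemma studentized_square_tail:
  fixes est :: "nat set set \<Rightarrow> nat \<Rightarrow> real"
  assumes v: "v \<in> J" and J: "J \<subseteq> V" and large: "N ^ 3 > 2 * C1"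
    and est: "\<And>\<omega>. \<exists>!\<beta>. is_ml_estimate n s {e \<in> I. \<omega> e} \<beta> \<Longrightarrow>
      is_ml_estimate n s {e \<in> I. \<omega> e} (est {e \<in> I. \<omega> e})"
  shows "measure_pmf.prob P {\<omega>. \<bar>plugin_var n s (est {e \<in> I. \<omega> e}) v * (est {e \<in> I. \<omega> e} v - \<theta> v)\<^sup>2
      - (Z J v \<omega>)\<^sup>2\<bar> > C4 / N} \<le> 2 * (N ^ 8 * exp (- 2 * N\<^sup>2)) + C3 (card J) / N ^ 4"
proof -
  let ?H = "\<lambda>\<omega>. {e \<in> I. \<omega> e}"
  let ?bad = "{\<omega>. \<bar>plugin_var n s (est (?H \<omega>)) v * (est (?H \<omega>) v - \<theta> v)\<^sup>2 - (Z J v \<omega>)\<^sup>2\<bar> > C4 / N}"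
  let ?A = "{\<omega>. \<not> (\<forall>v\<in>V. \<bar>resid (deg \<omega>) v\<bar> \<le> K)}"
  let ?R = "{\<omega>. \<bar>resid (deg \<omega>) v - (\<Sum>u\<in>V. corr v u * resid (deg \<omega>) u)
      - sqrt (var v) * Z J v \<omega>\<bar> \<ge> sqrt m / N\<^sup>2}"
  have "?bad \<subseteq> ?A \<union> ?R"
  proof (rule subsetI, rule ccontr)
    fix \<omega> assume bad: "\<omega> \<in> ?bad" and not: "\<omega> \<notin> ?A \<union> ?R"
    have resid: "\<And>v. v \<in> V \<Longrightarrow> \<bar>resid (deg \<omega>) v\<bar> \<le> K" using not by auto
    obtain b where b: "\<And>\<beta>. is_ml_estimate n s (?H \<omega>) \<beta> \<longleftrightarrow> \<beta> = b"
      "\<And>v. v \<in> V \<Longrightarrow> (\<Sum>e\<in>star v. logistic (sum b e)) = deg \<omega> v"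
      "\<And>v. v \<in> V \<Longrightarrow> \<bar>b v - \<theta> v\<bar> \<le> \<delta>"
      using ml_estimate_characterization[OF neg_log_lik_eq resid large] by blast
    have "is_ml_estimate n s (?H \<omega>) (est (?H \<omega>))" by (rule est) (auto simp: b(1))
    hence "est (?H \<omega>) = b" by (simp add: b(1))
    moreover have "\<bar>plugin_var n s b v * (b v - \<theta> v)\<^sup>2 - (Z J v \<omega>)\<^sup>2\<bar> \<le> C4 / N"
      using v J not by (intro studentized_square_approx[OF _ b(2,3)]) auto
    ultimately show False using bad by auto
  qed
  hence "measure_pmf.prob P ?bad \<le> measure_pmf.prob P (?A \<union> ?R)"
    by (intro measure_pmf.finite_measure_mono) auto
  also have "\<dots> \<le> measure_pmf.prob P ?A + measure_pmf.prob P ?R"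
    by (intro measure_Un_le) auto
  also have "\<dots> \<le> 2 * (N ^ 8 * exp (- 2 * N\<^sup>2)) + C3 (card J) / N ^ 4"
    by (intro add_mono resid_tail remainder_tail v J)
  finally show ?thesis .
qed

end

text \<open>Up to the event that X and Y differ by more than h, the event X \<le> x lies between Y
  \<le> x - h and Y \<le> x + h. Continuity of F at x chooses h before n is sent to
  infinity.\<close>

lemma slutsky_cdf:
  fixes X Y :: "nat \<Rightarrow> 'a \<Rightarrow> real" and F :: "real \<Rightarrow> real"
  assumes F: "isCont F x"
    and Y: "\<And>y. (\<lambda>n. measure_pmf.prob (P n) {\<omega>. Y n \<omega> \<le> y}) \<longlonglongrightarrow> F y"
    and XY: "\<And>\<epsilon>. \<epsilon> > 0 \<Longrightarrow> (\<lambda>n. measure_pmf.prob (P n) {\<omega>. \<bar>X n \<omega> - Y n \<omega>\<bar> > \<epsilon>}) \<longlonglongrightarrow> 0"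
  shows "(\<lambda>n. measure_pmf.prob (P n) {\<omega>. X n \<omega> \<le> x}) \<longlonglongrightarrow> F x"
proof (rule tendstoI)
  fix e :: real assume e: "e > 0"
  have e3: "e / 3 > 0" using e by simp
  have "\<exists>d>0. \<forall>y. \<bar>y - x\<bar> < d \<longrightarrow> \<bar>F y - F x\<bar> < e / 3"
    using F[unfolded continuous_at_eps_delta, rule_format, OF e3] by (simp add: dist_real_def)
  then obtain d where d: "d > 0" "\<And>y. \<bar>y - x\<bar> < d \<Longrightarrow> \<bar>F y - F x\<bar> < e / 3" by blast
  define h where "h = d / 2"
  have h: "h > 0" "\<bar>F (x + h) - F x\<bar> < e / 3" "\<bar>F (x - h) - F x\<bar> < e / 3"
    using d by (auto simp: h_def)
  let ?p = "\<lambda>n y. measure_pmf.prob (P n) {\<omega>. Y n \<omega> \<le> y}"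
  let ?q = "\<lambda>n. measure_pmf.prob (P n) {\<omega>. \<bar>X n \<omega> - Y n \<omega>\<bar> > h}"
  let ?r = "\<lambda>n. measure_pmf.prob (P n) {\<omega>. X n \<omega> \<le> x}"
  have up: "?r n \<le> ?p n (x + h) + ?q n" for n
  proof -
    have "?r n \<le> measure_pmf.prob (P n) ({\<omega>. Y n \<omega> \<le> x + h} \<union> {\<omega>. \<bar>X n \<omega> - Y n \<omega>\<bar> > h})"
      by (intro measure_pmf.finite_measure_mono) auto
    also have "\<dots> \<le> ?p n (x + h) + ?q n" by (intro measure_Un_le) auto
    finally show ?thesis .
  qed
  have low: "?p n (x - h) \<le> ?r n + ?q n" for n
  proof -
    have "?p n (x - h) \<le> measure_pmf.prob (P n) ({\<omega>. X n \<omega> \<le> x} \<union> {\<omega>. \<bar>X n \<omega> - Y n \<omega>\<bar> > h})"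
      by (intro measure_pmf.finite_measure_mono) auto
    also have "\<dots> \<le> ?r n + ?q n" by (intro measure_Un_le) auto
    finally show ?thesis .
  qed
  have "eventually (\<lambda>n. dist (?p n (x + h)) (F (x + h)) < e / 3) sequentially"
    "eventually (\<lambda>n. dist (?p n (x - h)) (F (x - h)) < e / 3) sequentially"
    "eventually (\<lambda>n. dist (?q n) 0 < e / 3) sequentially"
    using tendstoD[OF Y e3] tendstoD[OF XY[OF h(1)] e3] by auto
  thus "eventually (\<lambda>n. dist (?r n) (F x) < e) sequentially"
  proof eventually_elim
    case (elim n)
    thus ?case using up[of n] low[of n] h unfolding dist_real_def by linarith
  qed
qed

text \<open>Levy's continuity theorem makes \<open>Z\<close> asymptotically standard normal, and
  \<open>iexp (t * x\<^sup>2)\<close> is a bounded continuous function of x. Node and set may vary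
  with n, because the estimate for \<open>Z\<close> depends on J only through its cardinality
  a.\<close>

lemma Z_square_char_tendsto:
  assumes ev: "\<forall>\<^sub>F n in sequentially. beta_layer_field n s M (\<theta> n) (I n) (p n) \<and> v n \<in> J n \<and> J n \<subseteq> {1..n} \<and> card (J n) = a"
  shows "(\<lambda>n. measure_pmf.expectation (Pi_pmf (I n) False (\<lambda>e. bernoulli_pmf (p n e)))
      (\<lambda>\<omega>. iexp (t * (beta_layer_field.Z n s (\<theta> n) (p n) (J n) (v n) \<omega>)\<^sup>2))) \<longlonglongrightarrow> square_char t"
proof -
  let ?P = "\<lambda>n. Pi_pmf (I n) False (\<lambda>e. bernoulli_pmf (p n e))"
  let ?Z = "\<lambda>n. beta_layer_field.Z n s (\<theta> n) (p n) (J n) (v n)"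
  let ?\<mu> = "\<lambda>n. distr (measure_pmf (?P n)) borel (?Z n)"
  have real: "real_distribution (?\<mu> n)" for n
    by (rule prob_space.real_distribution_distr) (auto simp: measure_pmf.prob_space_axioms)
  have weak: "weak_conv_m ?\<mu> std_normal_distribution"
  proof (rule levy_continuity[OF real real_dist_normal_dist])
    fix t :: real
    let ?\<kappa> = "beta_layer.\<kappa> s M"
    define C where "C = (2 * \<bar>t\<bar> ^ 3 + 2 * t ^ 4) / ?\<kappa>\<^sup>2 + 2 * real s * real a * t\<^sup>2 / ?\<kappa>"
    have char: "char (?\<mu> n) t = measure_pmf.expectation (?P n) (\<lambda>\<omega>. iexp (t * ?Z n \<omega>))" for n
      unfolding char_def by (subst integral_distr) auto
    have "\<forall>\<^sub>F n in sequentially. cmod (char (?\<mu> n) t - complex_of_real (exp (- (t\<^sup>2) / 2)))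
        \<le> C / (real n powr (1/8)) ^ 4"
      using ev
    proof eventually_elim
      case (elim n)
      then interpret beta_layer_field n s M "\<theta> n" "I n" "p n" by blast
      have "v n \<in> J n" "J n \<subseteq> V" "card (J n) = a" using elim by (auto simp: V_def)
      thus ?case using char_Z_approx[of "v n" "J n" t] 
          unfolding N_def P_def C_def char by simp
    qed
    moreover have "(\<lambda>n. C / (real n powr (1/8)) ^ 4) \<longlonglongrightarrow> 0"
      by real_asymp
    ultimately have "(\<lambda>n. char (?\<mu> n) t - complex_of_real (exp (- (t\<^sup>2) / 2))) \<longlonglongrightarrow> 0"
      by (rule Lim_null_comparison)
    thus "(\<lambda>n. char (?\<mu> n) t) \<longlonglongrightarrow> char std_normal_distribution t"
      unfolding char_std_normal_distribution by (simp add: LIM_zero_iff)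
  qed
  have "(\<lambda>n. LINT x|?\<mu> n. iexp (t * x\<^sup>2)) \<longlonglongrightarrow> square_char t"
    by (rule weak_conv_imp_integral_bdd_continuous_conv[OF real real_dist_normal_dist weak, where B = 1])
       (auto intro!: continuous_intros)
  thus ?thesis by (subst (asm) integral_distr) auto
qed

section \<open>All layers together\<close>

lemma edge_prob_eq_logistic: "edge_prob \<beta> e = logistic (sum \<beta> e)"
  by (simp add: edge_prob_def logistic_def)

lemma quad_form_diag:
  assumes "finite A"
  shows "quad_form A (diag d) x = (\<Sum>v\<in>A. d v * (x v)\<^sup>2)"
proof -
  have "(\<Sum>v\<in>A. x u * diag d u v * x v) = d u * (x u)\<^sup>2" if "u \<in> A" for u
  proof -
    have "(\<Sum>v\<in>A. x u * diag d u v * x v) = (\<Sum>v\<in>A. if v = u then d u * (x u)\<^sup>2 else 0)"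
      by (intro sum.cong) (auto simp: diag_def power2_eq_square)
    thus ?thesis using assms that by simp
  qed
  thus ?thesis by (simp add: quad_form_def)
qed

lemma powr_eighth_limits:
  fixes c :: real
  defines "N \<equiv> \<lambda>n. real n powr (1/8)"
  shows "filterlim (\<lambda>n. N n ^ 3) at_top sequentially" "(\<lambda>n. c / N n) \<longlonglongrightarrow> 0"
    "(\<lambda>n. 2 * (N n ^ 8 * exp (- 2 * (N n)\<^sup>2)) + c / N n ^ 4) \<longlonglongrightarrow> 0"
proof -
  have 1: "(\<lambda>n. 2 * (N n ^ 8 * exp (- 2 * (N n)\<^sup>2))) \<longlonglongrightarrow> 0" unfolding N_def by real_asymp
  have 2: "(\<lambda>n. c / N n ^ 4) \<longlonglongrightarrow> 0" unfolding N_def by real_asymp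
  show "(\<lambda>n. 2 * (N n ^ 8 * exp (- 2 * (N n)\<^sup>2)) + c / N n ^ 4) \<longlonglongrightarrow> 0"
    using tendsto_add[OF 1 2] by simp
qed (unfold N_def, real_asymp+)

text \<open>Parameters and node sets vary with n under bounds that do not. The condition on J is
  imposed only eventually, since for small n the set {1..n} has no subset of size
  \<open>a s\<close>.\<close>

locale layered_sequence =
  fixes r :: nat and M :: real and B :: "nat \<Rightarrow> nat \<Rightarrow> nat \<Rightarrow> real" and a :: "nat \<Rightarrow> nat"
    and J :: "nat \<Rightarrow> nat \<Rightarrow> nat set"
  assumes M_pos: "M > 0"
    and B_bound: "\<And>n s v. s \<in> {2..r} \<Longrightarrow> v \<in> {1..n} \<Longrightarrow> \<bar>B n s v\<bar> \<le> M"
    and J_eventually: "\<forall>\<^sub>F n in sequentially. \<forall>s\<in>{2..r}. J n s \<subseteq> {1..n} \<and> card (J n s) = a s"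
begin

definition I :: "nat \<Rightarrow> nat set set" where "I n = hyperedges r n"
definition p :: "nat \<Rightarrow> nat set \<Rightarrow> real" where "p n e = edge_prob (B n (card e)) e"
definition P :: "nat \<Rightarrow> (nat set \<Rightarrow> bool) pmf" where
  "P n = Pi_pmf (I n) False (\<lambda>e. bernoulli_pmf (p n e))"
definition H :: "nat \<Rightarrow> (nat set \<Rightarrow> bool) \<Rightarrow> nat set set" where "H n \<omega> = {e \<in> I n. \<omega> e}"
definition Z :: "nat \<Rightarrow> nat \<Rightarrow> nat \<Rightarrow> (nat set \<Rightarrow> bool) \<Rightarrow> real" where
  "Z n s v = beta_layer_field.Z n s (B n s) (p n) (J n s) v"
text \<open>The proxy with independent summands for \<open>Q\<close>, which is the statistic itself
  with its diagonal quadratic forms written as weighted sums of squares.\<close>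

definition W :: "nat \<Rightarrow> (nat set \<Rightarrow> bool) \<Rightarrow> real" where
  "W n \<omega> = (\<Sum>s=2..r. \<Sum>v\<in>J n s. (Z n s v \<omega>)\<^sup>2)"
definition Q :: "(nat \<Rightarrow> nat \<Rightarrow> nat set set \<Rightarrow> nat \<Rightarrow> real) \<Rightarrow> nat \<Rightarrow> (nat set \<Rightarrow> bool) \<Rightarrow> real" where
  "Q est n \<omega> = (\<Sum>s=2..r. \<Sum>v\<in>J n s. plugin_var n s (est n s (H n \<omega>)) v * (est n s (H n \<omega>) v - B n s v)\<^sup>2)"

lemma layered_beta_model_eq: "layered_beta_model r n (B n) = map_pmf (H n) (P n)"
  by (simp add: layered_beta_model_def H_def[abs_def] P_def I_def p_def)

lemma bernoulli_field: "bernoulli_field (I n) (p n)"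
proof
  show "finite (I n)" by (simp add: I_def hyperedges_def finite_imp_finite_nsets)
qed (simp add: p_def edge_prob_eq_logistic logistic_bounds)

lemma P_eq: "bernoulli_field.P (I n) (p n) = P n"
  by (simp add: bernoulli_field.P_def[OF bernoulli_field] P_def)

lemma beta_layer_field:
  assumes "2 * r \<le> n" "s \<in> {2..r}"
  shows "beta_layer_field n s M (B n s) (I n) (p n)"
proof -
  have layer: "beta_layer n s M (B n s)"
    using assms M_pos B_bound by unfold_locales auto
  show ?thesis
  proof (intro beta_layer_field.intro beta_layer_field_axioms.intro layer bernoulli_field)
    show "beta_layer.E n s = {e \<in> I n. card e = s}"
      using assms by (auto simp: beta_layer.E_def[OF layer] I_def hyperedges_def nsets_def)
    show "p n e = beta_layer.prob (B n s) e" if "e \<in> beta_layer.E n s" for e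
      using that by (simp add: beta_layer.E_def[OF layer] beta_layer.prob_def[OF layer] p_def
          edge_prob_eq_logistic nsets_def)
  qed
qed

definition good :: "nat \<Rightarrow> bool" where
  "good n \<longleftrightarrow> 2 * r \<le> n \<and> (\<forall>s\<in>{2..r}. J n s \<subseteq> {1..n} \<and> card (J n s) = a s)"

lemma eventually_good: "eventually good sequentially"
  unfolding good_def using eventually_ge_at_top[of "2 * r"] J_eventually by (rule eventually_conj)

lemma good_finite: "good n \<Longrightarrow> s \<in> {2..r} \<Longrightarrow> finite (J n s)"
  unfolding good_def by (meson finite_atLeastAtMost finite_subset)

text \<open>Replaces the index set \<open>J n s\<close>, which moves with n, by a fixed one, so that
  limits can be taken factor by factor in a product.\<close>

definition enum :: "nat \<Rightarrow> nat \<Rightarrow> nat \<Rightarrow> nat" where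
  "enum n s = (SOME h. bij_betw h {..<a s} (J n s))"

lemma bij_betw_enum: "good n \<Longrightarrow> s \<in> {2..r} \<Longrightarrow> bij_betw (enum n s) {..<a s} (J n s)"
proof -
  assume "good n" "s \<in> {2..r}"
  hence "\<exists>h. bij_betw h {..<a s} (J n s)"
    using ex_bij_betw_nat_finite[OF good_finite[of n s]] by (auto simp: good_def atLeast0LessThan)
  thus "bij_betw (enum n s) {..<a s} (J n s)" unfolding enum_def by (rule someI_ex)
qed

text \<open>The blocks \<open>own\<close> of distinct pairs (s, v) are disjoint: for different s
  their hyperedges differ in size, for equal s and different v in their intersection with
  \<open>J n s\<close>. This gives independence over nodes and layers at once.\<close>

lemma expectation_iexp_W:
  assumes good: "good n"
  shows "measure_pmf.expectation (P n) (\<lambda>\<omega>. iexp (t * W n \<omega>))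
    = (\<Prod>s=2..r. \<Prod>i<a s. measure_pmf.expectation (P n) (\<lambda>\<omega>. iexp (t * (Z n s (enum n s i) \<omega>)\<^sup>2)))"
proof -
  interpret F: bernoulli_field "I n" "p n" by (rule bernoulli_field)
  note layer = beta_layer_field[OF good[unfolded good_def, THEN conjunct1]]
  let ?L = "SIGMA s:{2..r}. J n s"
  let ?G = "\<lambda>x \<omega>. iexp (t * (Z n (fst x) (snd x) \<omega>)\<^sup>2)"
  let ?K = "\<lambda>x. beta_layer_field.own n (fst x) (J n (fst x)) (snd x)"
  have own: "beta_layer_field.own n s (J n s) v = {e \<in> I n. card e = s \<and> v \<in> e \<and> e \<inter> J n s = {v}}"
    if "s \<in> {2..r}" for s v
  proof -
    interpret L: beta_layer_field n s M "B n s" "I n" "p n" by (rule layer[OF that])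
    show ?thesis by (auto simp: L.own_def L.star_def L.E_eq_layer)
  qed
  have finL: "finite ?L" using good_finite[OF good] by auto
  have "iexp (t * W n \<omega>) = (\<Prod>x\<in>?L. ?G x \<omega>)" for \<omega>
  proof -
    have "t * W n \<omega> = (\<Sum>x\<in>?L. t * (Z n (fst x) (snd x) \<omega>)\<^sup>2)"
      using good_finite[OF good]
      by (simp add: W_def sum_distrib_left sum.Sigma case_prod_unfold)
    thus ?thesis by (simp add: sum_distrib_left exp_sum[OF finL])
  qed
  hence "measure_pmf.expectation (P n) (\<lambda>\<omega>. iexp (t * W n \<omega>))
      = measure_pmf.expectation (P n) (\<lambda>\<omega>. \<Prod>x\<in>?L. ?G x \<omega>)" by simp
  also have "\<dots> = (\<Prod>x\<in>?L. measure_pmf.expectation (P n) (?G x))"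
    unfolding P_eq[symmetric]
  proof (rule F.expectation_prod_blocks[OF finL, where K = ?K])
    show "?K x \<subseteq> I n" if "x \<in> ?L" for x using that by (auto simp: own)
    show "disjoint_family_on ?K ?L"
      unfolding disjoint_family_on_def
    proof (intro ballI impI)
      fix x y assume "x \<in> ?L" "y \<in> ?L" "x \<noteq> y"
      thus "?K x \<inter> ?K y = {}" by (cases x; cases y) (auto simp: own)
    qed
    fix x and \<omega> \<omega>' :: "nat set \<Rightarrow> bool" assume x: "x \<in> ?L" and eq: "\<And>e. e \<in> ?K x \<Longrightarrow> \<omega> e = \<omega>' e"
    interpret L: beta_layer_field n "fst x" M "B n (fst x)" "I n" "p n" by (rule layer) (use x in auto)
    have "Z n (fst x) (snd x) \<omega> = Z n (fst x) (snd x) \<omega>'"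
      unfolding Z_def L.Z_def by (intro sum.cong refl) (simp add: F.U_def eq)
    thus "?G x \<omega> = ?G x \<omega>'" by simp
  qed
  also have "\<dots> = (\<Prod>s=2..r. \<Prod>v\<in>J n s. measure_pmf.expectation (P n) (\<lambda>\<omega>. iexp (t * (Z n s v \<omega>)\<^sup>2)))"
    using good_finite[OF good] by (simp add: prod.Sigma case_prod_unfold)
  also have "\<dots> = (\<Prod>s=2..r. \<Prod>i<a s. measure_pmf.expectation (P n) (\<lambda>\<omega>. iexp (t * (Z n s (enum n s i) \<omega>)\<^sup>2)))"
    by (intro prod.cong refl prod.reindex_bij_betw[symmetric] bij_betw_enum good)
  finally show ?thesis .
qed

lemma expectation_iexp_W_tendsto:
  "(\<lambda>n. measure_pmf.expectation (P n) (\<lambda>\<omega>. iexp (t * W n \<omega>))) \<longlonglongrightarrow> square_char t ^ (\<Sum>s=2..r. a s)"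
proof -
  have "(\<lambda>n. \<Prod>s=2..r. \<Prod>i<a s. measure_pmf.expectation (P n) (\<lambda>\<omega>. iexp (t * (Z n s (enum n s i) \<omega>)\<^sup>2)))
      \<longlonglongrightarrow> (\<Prod>s=2..r. \<Prod>i<a s. square_char t)"
  proof (intro tendsto_prod)
    fix s i assume s: "s \<in> {2..r}" and i: "i \<in> {..<a s}"
    show "(\<lambda>n. measure_pmf.expectation (P n) (\<lambda>\<omega>. iexp (t * (Z n s (enum n s i) \<omega>)\<^sup>2))) \<longlonglongrightarrow> square_char t"
      unfolding P_def Z_def
    proof (rule Z_square_char_tendsto[where M = M and a = "a s"])
      show "\<forall>\<^sub>F n in sequentially. beta_layer_field n s M (B n s) (I n) (p n) \<and> enum n s i \<in> J n s \<and>
          J n s \<subseteq> {1..n} \<and> card (J n s) = a s"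
        using eventually_good
      proof eventually_elim
        case (elim n)
        thus ?case using beta_layer_field[of n s] s i bij_betw_enum[OF elim s]
          by (auto simp: good_def bij_betw_def)
      qed
    qed
  qed
  also have "(\<Prod>s=2..r. \<Prod>i<a s. square_char t) = square_char t ^ (\<Sum>s=2..r. a s)"
    by (simp add: power_sum)
  finally show ?thesis
    by (rule Lim_transform_eventually)
       (use eventually_good in eventually_elim, simp only: expectation_iexp_W)
qed

text \<open>Convergence of characteristic functions gives weak convergence, and continuity of the
  limiting cdf, which requires at least one degree of freedom, gives convergence at every y.\<close>

lemma W_cdf_tendsto:
  assumes "(\<Sum>s=2..r. a s) > 0"
  shows "(\<lambda>n. measure_pmf.prob (P n) {\<omega>. W n \<omega> \<le> y}) \<longlonglongrightarrow> cdf (chi_squared (\<Sum>s=2..r. a s)) y"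
proof -
  let ?k = "\<Sum>s=2..r. a s"
  let ?\<mu> = "\<lambda>n. distr (measure_pmf (P n)) borel (W n)"
  have real: "real_distribution (?\<mu> n)" for n
    by (rule prob_space.real_distribution_distr) (auto simp: measure_pmf.prob_space_axioms)
  have "weak_conv_m ?\<mu> (chi_squared ?k)"
  proof (rule levy_continuity[OF real real_distribution_chi_squared])
    fix t
    have "char (?\<mu> n) t = measure_pmf.expectation (P n) (\<lambda>\<omega>. iexp (t * W n \<omega>))" for n
      unfolding char_def by (subst integral_distr) auto
    thus "(\<lambda>n. char (?\<mu> n) t) \<longlonglongrightarrow> char (chi_squared ?k) t"
      using expectation_iexp_W_tendsto[of t] by (simp add: char_chi_squared)
  qed
  hence "(\<lambda>n. cdf (?\<mu> n) y) \<longlonglongrightarrow> cdf (chi_squared ?k) y"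
    using isCont_cdf_chi_squared[OF assms] by (auto simp: weak_conv_m_def weak_conv_def)
  moreover have "cdf (?\<mu> n) y = measure_pmf.prob (P n) {\<omega>. W n \<omega> \<le> y}" for n
    unfolding cdf_def by (subst measure_distr) (auto simp: vimage_def)
  ultimately show ?thesis by simp
qed

text \<open>The difference is a sum of a fixed number of terms, each of which exceeds
  \<open>C4 s / N n\<close> only with probability at most \<open>tail n s\<close>. A union bound
  finishes the argument.\<close>

lemma Q_W_tail_tendsto:
  assumes est: "\<And>n s. s \<in> {2..r} \<Longrightarrow> ml_estimator r n s (est n s)" and "\<epsilon> > 0"
  shows "(\<lambda>n. measure_pmf.prob (P n) {\<omega>. \<bar>Q est n \<omega> - W n \<omega>\<bar> > \<epsilon>}) \<longlonglongrightarrow> 0"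
proof -
  define N where "N n = real n powr (1/8)" for n :: nat
  define C4 where "C4 s = beta_layer.C4 s M" for s
  define C3 where "C3 s = beta_layer_field.C3 s M (a s)" for s
  define tail where "tail n s = 2 * (N n ^ 8 * exp (- 2 * (N n)\<^sup>2)) + C3 s / N n ^ 4" for n s
  have large: "\<forall>\<^sub>F n in sequentially. \<forall>s\<in>{2..r}. N n ^ 3 > 2 * beta_layer.C1 s M"
  proof (intro eventually_ball_finite ballI)
    fix s
    have "filterlim (\<lambda>n. N n ^ 3) at_top sequentially"
      unfolding N_def by (rule powr_eighth_limits)
    thus "\<forall>\<^sub>F n in sequentially. N n ^ 3 > 2 * beta_layer.C1 s M"
      unfolding filterlim_at_top_dense by blast
  qed auto
  have lim0: "(\<lambda>n. c / N n) \<longlonglongrightarrow> 0" for c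
    unfolding N_def by (rule powr_eighth_limits)
  \<comment> \<open>Once the deviations allowed for all terms add up to less than \<epsilon>, a
    deviation above \<epsilon> forces one of the bad events.\<close>
  have small: "\<forall>\<^sub>F n in sequentially. (\<Sum>s=2..r. real (a s) * C4 s) / N n < \<epsilon>"
    using order_tendstoD(2)[OF lim0 \<open>\<epsilon> > 0\<close>] .
  have "\<forall>\<^sub>F n in sequentially. norm (measure_pmf.prob (P n) {\<omega>. \<bar>Q est n \<omega> - W n \<omega>\<bar> > \<epsilon>})
      \<le> (\<Sum>s=2..r. real (a s) * tail n s)"
    using eventually_good large small
  proof eventually_elim
    case (elim n)
    let ?q = "\<lambda>s v \<omega>. plugin_var n s (est n s (H n \<omega>)) v * (est n s (H n \<omega>) v - B n s v)\<^sup>2"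
    let ?bad = "\<lambda>s v. {\<omega>. \<bar>?q s v \<omega> - (Z n s v \<omega>)\<^sup>2\<bar> > C4 s / N n}"
    have card: "card (J n s) = a s" if "s \<in> {2..r}" for s using elim(1) that by (auto simp: good_def)
    have tail: "measure_pmf.prob (P n) (?bad s v) \<le> tail n s" if s: "s \<in> {2..r}" and v: "v \<in> J n s" for s v
    proof -
      interpret L: beta_layer_field n s M "B n s" "I n" "p n"
        using beta_layer_field[of n s] elim(1) s by (auto simp: good_def)
      have N_eq: "beta_layer.N n = N n" by (simp add: N_def L.N_def)
      have J: "J n s \<subseteq> beta_layer.V n" using elim(1) s by (auto simp: good_def L.V_def)
      have lg: "beta_layer.N n ^ 3 > 2 * beta_layer.C1 s M" using elim(2) s by (simp add: N_eq)
      have "is_ml_estimate n s {e \<in> I n. \<omega> e} (est n s {e \<in> I n. \<omega> e})"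
        if "\<exists>!\<beta>. is_ml_estimate n s {e \<in> I n. \<omega> e} \<beta>" for \<omega>
      proof -
        have "{e \<in> I n. \<omega> e} \<subseteq> hyperedges r n" by (auto simp: I_def)
        thus ?thesis using est[OF s, of n, unfolded ml_estimator_def, rule_format] that by blast
      qed
      from L.studentized_square_tail[OF v J lg this] show ?thesis
        unfolding P_eq N_eq tail_def C3_def C4_def card[OF s] H_def Z_def .
    qed
    have "{\<omega>. \<bar>Q est n \<omega> - W n \<omega>\<bar> > \<epsilon>} \<subseteq> (\<Union>s\<in>{2..r}. \<Union>v\<in>J n s. ?bad s v)"
    proof (rule subsetI, rule ccontr)
      fix \<omega> assume \<omega>: "\<omega> \<in> {\<omega>. \<bar>Q est n \<omega> - W n \<omega>\<bar> > \<epsilon>}"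
        and not: "\<omega> \<notin> (\<Union>s\<in>{2..r}. \<Union>v\<in>J n s. ?bad s v)"
      have "\<bar>Q est n \<omega> - W n \<omega>\<bar> = \<bar>\<Sum>s=2..r. \<Sum>v\<in>J n s. ?q s v \<omega> - (Z n s v \<omega>)\<^sup>2\<bar>"
        by (simp add: Q_def W_def sum_subtractf)
      also have "\<dots> \<le> (\<Sum>s=2..r. \<Sum>v\<in>J n s. \<bar>?q s v \<omega> - (Z n s v \<omega>)\<^sup>2\<bar>)"
        by (rule order_trans[OF sum_abs], intro sum_mono sum_abs)
      also have "\<dots> \<le> (\<Sum>s=2..r. \<Sum>v\<in>J n s. C4 s / N n)"
        using not by (intro sum_mono) (auto simp: not_less)
      also have "\<dots> = (\<Sum>s=2..r. real (a s) * C4 s) / N n"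
        by (simp add: card sum_divide_distrib)
      finally show False using elim(3) \<omega> by simp
    qed
    hence "measure_pmf.prob (P n) {\<omega>. \<bar>Q est n \<omega> - W n \<omega>\<bar> > \<epsilon>}
        \<le> measure_pmf.prob (P n) (\<Union>s\<in>{2..r}. \<Union>v\<in>J n s. ?bad s v)"
      by (intro measure_pmf.finite_measure_mono) auto
    also have "\<dots> \<le> (\<Sum>s=2..r. measure_pmf.prob (P n) (\<Union>v\<in>J n s. ?bad s v))"
      by (intro measure_pmf.finite_measure_subadditive_finite) auto
    also have "\<dots> \<le> (\<Sum>s=2..r. \<Sum>v\<in>J n s. measure_pmf.prob (P n) (?bad s v))"
      by (intro sum_mono measure_pmf.finite_measure_subadditive_finite good_finite elim(1)) auto
    also have "\<dots> \<le> (\<Sum>s=2..r. \<Sum>v\<in>J n s. tail n s)"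
      by (intro sum_mono tail)
    also have "\<dots> = (\<Sum>s=2..r. real (a s) * tail n s)" by (simp add: card)
    finally show ?case by simp
  qed
  moreover have "(\<lambda>n. \<Sum>s=2..r. real (a s) * tail n s) \<longlonglongrightarrow> 0"
  proof -
    have "(\<lambda>n. tail n s) \<longlonglongrightarrow> 0" for s
      unfolding tail_def N_def by (rule powr_eighth_limits)
    hence "(\<lambda>n. \<Sum>s=2..r. real (a s) * tail n s) \<longlonglongrightarrow> (\<Sum>s=2..r. real (a s) * 0)"
      by (intro tendsto_sum tendsto_mult tendsto_const)
    thus ?thesis by simp
  qed
  ultimately show ?thesis by (rule Lim_null_comparison)
qed

end

theorem theorem2p4:
  fixes r :: nat and M \<alpha> :: real
    and B :: "nat \<Rightarrow> nat \<Rightarrow> nat \<Rightarrow> real"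
    and a :: "nat \<Rightarrow> nat"
    and J :: "nat \<Rightarrow> nat \<Rightarrow> nat set"
    and est :: "nat \<Rightarrow> nat \<Rightarrow> nat set set \<Rightarrow> nat \<Rightarrow> real"
  assumes "r \<ge> 2" and "M > 0"
    and "\<And>n s v. s \<in> {2..r} \<Longrightarrow> v \<in> {1..n} \<Longrightarrow> \<bar>B n s v\<bar> \<le> M"
    and "\<And>s. s \<in> {2..r} \<Longrightarrow> a s \<ge> 1"
    and "\<forall>\<^sub>F n in sequentially. \<forall>s\<in>{2..r}. J n s \<subseteq> {1..n} \<and> card (J n s) = a s"
    and "\<And>n s. s \<in> {2..r} \<Longrightarrow> ml_estimator r n s (est n s)"
    and "0 < \<alpha>" and "\<alpha> < 1"
  shows "(\<lambda>n. measure_pmf.prob (layered_beta_model r n (B n))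
            {H. (\<Sum>s=2..r. quad_form (J n s)
                   (diag (plugin_var n s (est n s H)))
                   (\<lambda>v. est n s H v - B n s v))
                \<le> quantile (chi_squared (\<Sum>s=2..r. a s)) (1 - \<alpha>)})
         \<longlonglongrightarrow> 1 - \<alpha>"
proof -
  interpret layered_sequence r M B a J using assms(2,3,5) by unfold_locales
  let ?k = "\<Sum>s=2..r. a s"
  let ?q = "quantile (chi_squared ?k) (1 - \<alpha>)"
  \<comment> \<open>The layer s = 2 is always present, so the number of degrees of freedom is
    positive and the limiting cdf is continuous.\<close>
  have "a 2 \<le> ?k" using assms(1) by (intro member_le_sum) auto
  hence k: "?k > 0" using assms(4)[of 2] assms(1) by simp
  have "(\<lambda>n. measure_pmf.prob (P n) {\<omega>. Q est n \<omega> \<le> ?q}) \<longlonglongrightarrow> cdf (chi_squared ?k) ?q"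
    by (rule slutsky_cdf[OF isCont_cdf_chi_squared[OF k] W_cdf_tendsto[OF k] Q_W_tail_tendsto[OF assms(6)]])
  also have "cdf (chi_squared ?k) ?q = 1 - \<alpha>"
    using assms(7,8) by (intro cdf_quantile real_distribution_chi_squared isCont_cdf_chi_squared k) auto
  finally show ?thesis
  \<comment> \<open>For good n the sets \<open>J n s\<close> are finite, so each diagonal quadratic
    form is a weighted sum of squares; the event is then pulled back from hypergraphs to families of
    edge indicators.\<close>
  proof (rule Lim_transform_eventually)
    show "\<forall>\<^sub>F n in sequentially. measure_pmf.prob (P n) {\<omega>. Q est n \<omega> \<le> ?q} =
       measure_pmf.prob (layered_beta_model r n (B n))
            {H. (\<Sum>s=2..r. quad_form (J n s) (diag (plugin_var n s (est n s H)))
                   (\<lambda>v. est n s H v - B n s v)) \<le> ?q}"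
      using eventually_good
    proof eventually_elim
      case (elim n)
      show ?case
        unfolding layered_beta_model_eq measure_map_pmf
        using good_finite[OF elim]
        by (intro arg_cong[of _ _ "measure_pmf.prob (P n)"]) (auto simp: Q_def quad_form_diag)
    qed
  qed
qed

end
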